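(* Let $\mu$ be a $\boxplus$-infinitely divisible probability measure on $\mathbb{R}$, and let $\phi_\mu:\mathbb{C}^+\to\mathbb{C}^-\cup\mathbb{R}$ be the analytic extension of its Voiculescu transform. Assume: 1. for every $x\in\mathbb{R}$, either the nontangential limit of $\phi_\mu$ at $x$ exists in $\mathbb{C}$ and belongs to $\mathbb{C}^-$, or $\phi_\mu$ has no nontangential limit (in $\mathbb{C}\cup\{\infty\}$) at $x$; 2. at $\infty$, one of the following holds: (i) the nontangential limit of $\phi_\mu$ at $\infty$ is $\infty$; (ii) the nontangential limit of $\phi_\mu$ at $\infty$ exists and belongs to $\mathbb{C}^-$; (iii) the nontangential cluster set $C^\Delta(\phi_\mu,\infty)$ contains more than one point. Then for every Borel probability measure $\nu$ on $\mathbb{R}$, $\mu\boxplus\nu$ is absolutely continuous with respect to Lebesgue measure, with a density that is strictly positive and real-analytic on all of $\mathbb{R}$.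
   Context: $\mathbb{C}^\pm=\{z:\pm\operatorname{Im}z>0\}$. For a Borel probability measure $\mu$ on $\mathbb{R}$, $G_\mu(z)=\int(z-t)^{-1}d\mu(t)$ and $F_\mu=1/G_\mu:\mathbb{C}^+\to\mathbb{C}^+$. $F_\mu$ is injective on a region of the form $\{z:|z|>M,\ \operatorname{Im}z>\alpha|\operatorname{Re}z|\}$ and the Voiculescu transform is $\phi_\mu(z)=F_\mu^{-1}(z)-z$ on the image of such a region. The free convolution $\mu\boxplus\nu$ is the unique probability measure with $\phi_{\mu\boxplus\nu}=\phi_\mu+\phi_\nu$ on a common region near $\infty$. $\mu$ is $\boxplus$-infinitely divisible if for every $n$ it is the $n$-fold free convolution power of some probability measure; equivalently $\phi_\mu$ extends analytically to $\mathbb{C}^+$ with values in $\mathbb{C}^-\cup\mathbb{R}$ (this extension is also denoted $\phi_\mu$). Nontangential limit of $f$ at $x\in\mathbb{R}$: the limit of $f(z)$ as $z\to x$ within every cone $\{z\in\mathbb{C}^+:|\operatorname{Re}(z-x)|<c\operatorname{Im}z\}$, $c>0$; at $\infty$: as $|z|\to\infty$ within every cone $\{z\in\mathbb{C}^+:|\operatorname{Re}z|<c\operatorname{Im}z\}$. The nontangential cluster set $C^\Delta(f,\infty)$ is the closure in $\mathbb{C}\cup\{\infty\}$ of the union over $c>0$ of the sets of limits of $f(z_n)$ for sequences $z_n\to\infty$ in such cones. *)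

theory Defs
  imports "HOL-Probability.Probability"
begin

definition upper_half :: "complex set" where
  "upper_half = {z. Im z > 0}"

definition cauchy_transform :: "real measure \<Rightarrow> complex \<Rightarrow> complex" where
  "cauchy_transform \<mu> z = (\<integral>t. inverse (z - complex_of_real t) \<partial>\<mu>)"

definition F_transform :: "real measure \<Rightarrow> complex \<Rightarrow> complex" where
  "F_transform \<mu> z = 1 / cauchy_transform \<mu> z"

definition borel_prob :: "real measure \<Rightarrow> bool" where
  "borel_prob \<mu> \<longleftrightarrow> prob_space \<mu> \<and> sets \<mu> = sets borel"

definition trunc_cone :: "real \<Rightarrow> real \<Rightarrow> complex set" where
  "trunc_cone \<alpha> M = {z. cmod z > M \<and> Im z > \<alpha> * \<bar>Re z\<bar>}"

definition voiculescu_on :: "real measure \<Rightarrow> (complex \<Rightarrow> complex) \<Rightarrow> real \<Rightarrow> real \<Rightarrow> bool" where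
  "voiculescu_on \<mu> \<phi> \<alpha> M \<longleftrightarrow> \<alpha> > 0 \<and> M > 0 \<and>
     (\<exists>\<alpha>0 M0. \<alpha>0 > 0 \<and> M0 > 0 \<and> inj_on (F_transform \<mu>) (trunc_cone \<alpha>0 M0) \<and>
        trunc_cone \<alpha> M \<subseteq> F_transform \<mu> ` trunc_cone \<alpha>0 M0 \<and>
        (\<forall>z \<in> trunc_cone \<alpha> M. z + \<phi> z \<in> trunc_cone \<alpha>0 M0 \<and> F_transform \<mu> (z + \<phi> z) = z))"

definition free_conv :: "real measure \<Rightarrow> real measure \<Rightarrow> real measure \<Rightarrow> bool" where
  "free_conv \<mu> \<nu> \<rho> \<longleftrightarrow> borel_prob \<rho> \<and>
     (\<exists>\<alpha> M \<phi>1 \<phi>2. voiculescu_on \<mu> \<phi>1 \<alpha> M \<and> voiculescu_on \<nu> \<phi>2 \<alpha> M \<and>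
        voiculescu_on \<rho> (\<lambda>z. \<phi>1 z + \<phi>2 z) \<alpha> M)"

definition free_power :: "real measure \<Rightarrow> nat \<Rightarrow> real measure \<Rightarrow> bool" where
  "free_power \<nu> n \<mu> \<longleftrightarrow> borel_prob \<mu> \<and>
     (\<exists>\<alpha> M \<phi>. voiculescu_on \<nu> \<phi> \<alpha> M \<and> voiculescu_on \<mu> (\<lambda>z. of_nat n * \<phi> z) \<alpha> M)"

definition free_inf_div :: "real measure \<Rightarrow> bool" where
  "free_inf_div \<mu> \<longleftrightarrow> borel_prob \<mu> \<and> (\<forall>n\<ge>1. \<exists>\<nu>. borel_prob \<nu> \<and> free_power \<nu> n \<mu>)"

definition nt_cone :: "real \<Rightarrow> real \<Rightarrow> complex set" where
  "nt_cone x c = {z. Im z > 0 \<and> \<bar>Re z - x\<bar> < c * Im z}"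

definition nt_cone_inf :: "real \<Rightarrow> complex set" where
  "nt_cone_inf c = {z. Im z > 0 \<and> \<bar>Re z\<bar> < c * Im z}"

definition nt_lim_at :: "(complex \<Rightarrow> complex) \<Rightarrow> real \<Rightarrow> complex \<Rightarrow> bool" where
  "nt_lim_at f x L \<longleftrightarrow> (\<forall>c>0. (f \<longlongrightarrow> L) (at (complex_of_real x) within nt_cone x c))"

definition nt_lim_at_infty_value :: "(complex \<Rightarrow> complex) \<Rightarrow> real \<Rightarrow> bool" where
  "nt_lim_at_infty_value f x \<longleftrightarrow>
     (\<forall>c>0. filterlim f at_infinity (at (complex_of_real x) within nt_cone x c))"

definition nt_lim_inf :: "(complex \<Rightarrow> complex) \<Rightarrow> complex \<Rightarrow> bool" where
  "nt_lim_inf f L \<longleftrightarrow> (\<forall>c>0. (f \<longlongrightarrow> L) (at_infinity \<sqinter> principal (nt_cone_inf c)))"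

definition nt_lim_inf_infty :: "(complex \<Rightarrow> complex) \<Rightarrow> bool" where
  "nt_lim_inf_infty f \<longleftrightarrow> (\<forall>c>0. filterlim f at_infinity (at_infinity \<sqinter> principal (nt_cone_inf c)))"

definition nt_limit_values_inf :: "(complex \<Rightarrow> complex) \<Rightarrow> complex set" where
  "nt_limit_values_inf f = (\<Union>c\<in>{c. c > 0}. {w. \<exists>zs. (\<forall>n. zs n \<in> nt_cone_inf c) \<and>
      filterlim zs at_infinity sequentially \<and> ((\<lambda>n. f (zs n)) \<longlonglongrightarrow> w)})"

text \<open>The nontangential cluster set in the Riemann sphere C u {oo} is represented by its
  finite part (a subset of C) and a flag telling whether oo belongs to it.\<close>
definition nt_cluster_fin :: "(complex \<Rightarrow> complex) \<Rightarrow> complex set" where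
  "nt_cluster_fin f = closure (nt_limit_values_inf f)"

definition nt_cluster_has_infty :: "(complex \<Rightarrow> complex) \<Rightarrow> bool" where
  "nt_cluster_has_infty f \<longleftrightarrow>
     (\<exists>c>0. \<exists>zs. (\<forall>n. zs n \<in> nt_cone_inf c) \<and> filterlim zs at_infinity sequentially \<and>
        filterlim (\<lambda>n. f (zs n)) at_infinity sequentially)
     \<or> \<not> bounded (nt_limit_values_inf f)"

definition nt_cluster_more_than_one :: "(complex \<Rightarrow> complex) \<Rightarrow> bool" where
  "nt_cluster_more_than_one f \<longleftrightarrow>
     (\<exists>a b. a \<in> nt_cluster_fin f \<and> b \<in> nt_cluster_fin f \<and> a \<noteq> b)
     \<or> (nt_cluster_has_infty f \<and> nt_cluster_fin f \<noteq> {})"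

definition real_analytic_on :: "(real \<Rightarrow> real) \<Rightarrow> real set \<Rightarrow> bool" where
  "real_analytic_on f S \<longleftrightarrow> (\<forall>x\<in>S. \<exists>r>0. \<exists>a::nat \<Rightarrow> real.
      \<forall>y. \<bar>y - x\<bar> < r \<longrightarrow> (\<lambda>n. a n * (y - x) ^ n) sums f y)"

end

theory Submission
  imports Defs "HOL-Complex_Analysis.Complex_Analysis"
begin

text \<open>
  Write \<Phi>(w) = w + \<phi>(F_\<nu>(w)) on the upper half-plane.  Comparing Voiculescu transforms near
  infinity gives F_\<rho> = F_\<nu> o \<omega>, where \<omega> is the inverse of \<Phi>, so that \<omega>(z) is the fixed point of
  the self-map f_z(w) = z - \<phi>(F_\<nu>(w)) of the half-plane.  It suffices to show that for every real x
  the equation \<Phi>(w) = x has a solution in the open half-plane: \<omega> then continues analytically across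
  x with values in the half-plane, G_\<rho> = G_\<nu> o \<omega> continues with negative imaginary part, and
  Stieltjes inversion gives the density -Im G_\<rho> / \<pi>.

  The fixed points for z = x + i/n stay bounded, by the Schwarz-Pick inequality against a high point
  of the imaginary axis.  If they accumulate at a real point a, the same inequality turns in the
  limit into Julia's inequality for f_x at a.  Along F_\<nu>(a + iy), y tending to 0, one extracts a
  limit b, real or infinite, and a second use of Julia's inequality shows that \<phi> has a real
  nontangential limit at b, which the hypotheses exclude.
\<close>

section \<open>The Schwarz-Pick inequality in the upper half-plane\<close>

text \<open>F_\<nu> need not have a limit at the bad point a, so boundary behaviour of \<phi> o
  F_\<nu> at a says nothing directly about \<phi>. What survives are rates. Put \<psi> = - \<phi>
  and g = F_\<nu>(a + \<i> y). Julia's inequality at a gives |\<psi>(g) - (a - x)| \<le> y, and y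
  \<le> Im g because F_\<nu> raises imaginary parts. Hence Im \<psi>(g) / Im g \<le> 1 along every
  subsequence with g tending to a real b, which is the hypothesis of Julia's lemma for \<psi> at b.
  If g tends to infinity, the corresponding bound is Im \<psi>(g) * |g|^2 \<le> C * Im g; it follows
  from - Im G_\<nu>(a + \<i> y) \<ge> c * y. Interior accumulation is impossible, since \<psi> would
  take a real value there. Continuation across x also requires a nonzero derivative of \<Phi> at the
  interior solution. Otherwise the self-map x - \<phi> o F_\<nu> has derivative 1 at a fixed point
  and is the identity, against \<phi>(F_\<nu>(\<i> Y)) = o(Y).\<close>

lemma mem_upper_half [simp]: "z \<in> upper_half \<longleftrightarrow> Im z > 0"
  by (simp add: upper_half_def)

lemma open_upper_half: "open upper_half"
  unfolding upper_half_def by (rule open_halfspace_Im_gt)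

lemma connected_upper_half: "connected upper_half"
  unfolding upper_half_def by (intro convex_connected convex_halfspace_Im_gt)

text \<open>The conformal map of the half-plane onto the unit disc sending \<open>w\<close> to 0;
  its modulus is the pseudo-hyperbolic distance of \<open>z\<close> and \<open>w\<close>.\<close>

definition cayley :: "complex \<Rightarrow> complex \<Rightarrow> complex" where
  "cayley w z = (z - w) / (z - cnj w)"

definition cayley_inv :: "complex \<Rightarrow> complex \<Rightarrow> complex" where
  "cayley_inv w \<zeta> = (w - \<zeta> * cnj w) / (1 - \<zeta>)"

text \<open>The shape A / (A + 4 * Im z * Im w) makes comparing two pseudo-hyperbolic distances the
  same as comparing the quotients of A by the product of the heights.\<close>

lemma norm_cayley_power2:
  assumes "Im z > 0" "Im w > 0"
  shows "(cmod (cayley w z))\<^sup>2 = (cmod (z - w))\<^sup>2 / ((cmod (z - w))\<^sup>2 + 4 * Im z * Im w)"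
proof -
  have "(cmod (z - cnj w))\<^sup>2 = (cmod (z - w))\<^sup>2 + 4 * Im z * Im w"
    unfolding cmod_power2 by (simp add: power2_eq_square algebra_simps)
  then show ?thesis
    by (simp add: cayley_def norm_divide power_divide)
qed

lemma norm_cayley_less_1:
  assumes "Im z > 0" "Im w > 0"
  shows "cmod (cayley w z) < 1"
proof -
  have "(cmod (cayley w z))\<^sup>2 < 1"
    using assms by (simp add: norm_cayley_power2 add_nonneg_pos)
  then show ?thesis
    by (simp add: power_less_one_iff)
qed

lemma cayley_denom_nonzero:
  assumes "Im z > 0" "Im w > 0"
  shows "z - cnj w \<noteq> 0"
  using assms by (auto simp: complex_eq_iff)

lemma cayley_inv_cayley:
  assumes "Im z > 0" "Im w > 0"
  shows "cayley_inv w (cayley w z) = z"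
proof -
  have 1: "z - cnj w \<noteq> 0" and 2: "w - cnj w \<noteq> 0"
    using assms by (auto simp: complex_eq_iff)
  have "1 - cayley w z = (w - cnj w) / (z - cnj w)"
    using 1 by (simp add: cayley_def field_simps)
  moreover have "w - cayley w z * cnj w = z * (w - cnj w) / (z - cnj w)"
    using 1 by (simp add: cayley_def field_simps)
  ultimately show ?thesis
    using 1 2 by (simp add: cayley_inv_def)
qed

lemma Im_cayley_inv_pos:
  assumes "cmod \<zeta> < 1" "Im w > 0"
  shows "Im (cayley_inv w \<zeta>) > 0"
proof -
  have ne: "1 - \<zeta> \<noteq> 0" using assms by auto
  have "(cmod \<zeta>)\<^sup>2 < 1"
    using assms by (simp add: power_less_one_iff)
  then have z1: "Re \<zeta> * Re \<zeta> + Im \<zeta> * Im \<zeta> < 1"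
    unfolding cmod_power2 by (simp add: power2_eq_square)
  have "Im ((w - \<zeta> * cnj w) * cnj (1 - \<zeta>)) = Im w * (1 - (Re \<zeta> * Re \<zeta> + Im \<zeta> * Im \<zeta>))"
    by (simp add: algebra_simps)
  also have "\<dots> > 0" using z1 assms by simp
  finally have p: "Im ((w - \<zeta> * cnj w) * cnj (1 - \<zeta>)) > 0" .
  have "cayley_inv w \<zeta> = (w - \<zeta> * cnj w) * cnj (1 - \<zeta>) / complex_of_real ((cmod (1 - \<zeta>))\<^sup>2)"
    unfolding cayley_inv_def by (metis complex_div_cnj of_real_power)
  then have "Im (cayley_inv w \<zeta>) = Im ((w - \<zeta> * cnj w) * cnj (1 - \<zeta>)) / (cmod (1 - \<zeta>))\<^sup>2"
    by (simp only: Im_divide_of_real)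
  then show ?thesis
    using p ne by (simp only: divide_pos_pos zero_less_power2 norm_eq_zero zero_less_norm_iff) simp
qed

text \<open>Conjugation with Cayley maps based at \<open>w\<close> and \<open>f w\<close> turns
  \<open>f\<close> into a self-map of the disc fixing 0, the setting of Schwarz's lemma.\<close>

lemma holomorphic_cayley_conj:
  assumes hol: "f holomorphic_on upper_half" and im: "\<And>z. Im z > 0 \<Longrightarrow> Im (f z) > 0"
    and w: "Im w > 0"
  shows "(\<lambda>\<zeta>. cayley (f w) (f (cayley_inv w \<zeta>))) holomorphic_on ball 0 1"
    and "cmod \<zeta> < 1 \<Longrightarrow> cmod (cayley (f w) (f (cayley_inv w \<zeta>))) < 1"
proof -
  have ci: "cayley_inv w holomorphic_on ball 0 1"
    unfolding cayley_inv_def by (intro holomorphic_intros) auto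
  have "(f \<circ> cayley_inv w) holomorphic_on ball 0 1"
    by (rule holomorphic_on_compose_gen[OF ci hol]) (use Im_cayley_inv_pos w in auto)
  then have h: "(\<lambda>\<zeta>. f (cayley_inv w \<zeta>)) holomorphic_on ball 0 1"
    by (simp add: o_def)
  show "(\<lambda>\<zeta>. cayley (f w) (f (cayley_inv w \<zeta>))) holomorphic_on ball 0 1"
    unfolding cayley_def
  proof (intro holomorphic_intros h)
    fix \<zeta> :: complex assume "\<zeta> \<in> ball 0 1"
    then have "Im (f (cayley_inv w \<zeta>)) > 0"
      by (intro im Im_cayley_inv_pos w) auto
    then show "f (cayley_inv w \<zeta>) - cnj (f w) \<noteq> 0"
      using cayley_denom_nonzero im[OF w] by blast
  qed
  show "cmod \<zeta> < 1 \<Longrightarrow> cmod (cayley (f w) (f (cayley_inv w \<zeta>))) < 1"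
    by (intro norm_cayley_less_1 im Im_cayley_inv_pos w)
qed

text \<open>Schwarz's lemma for the conjugated map. The inequality is kept free of quotients, so
  that for \<open>f w = w\<close> the factor \<open>Im w\<close> can be cancelled before
  \<open>w\<close> moves to the boundary.\<close>

theorem schwarz_pick_upper_half:
  assumes hol: "f holomorphic_on upper_half" and im: "\<And>z. Im z > 0 \<Longrightarrow> Im (f z) > 0"
    and z: "Im z > 0" and w: "Im w > 0"
  shows "(cmod (f z - f w))\<^sup>2 * (Im z * Im w) \<le> (cmod (z - w))\<^sup>2 * (Im (f z) * Im (f w))"
proof -
  define h where "h \<zeta> = cayley (f w) (f (cayley_inv w \<zeta>))" for \<zeta>
  have fpos: "Im (f z) > 0" "Im (f w) > 0" by (rule im[OF z], rule im[OF w])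
  have h0: "h 0 = 0" by (simp add: h_def cayley_def cayley_inv_def)
  have "cmod (h (cayley w z)) \<le> cmod (cayley w z)"
    using Schwarz_Lemma(1)[of h "cayley w z"] h0 holomorphic_cayley_conj[OF hol im w]
      norm_cayley_less_1[OF z w] unfolding h_def by blast
  then have "cmod (cayley (f w) (f z)) \<le> cmod (cayley w z)"
    by (simp add: h_def cayley_inv_cayley z w)
  then have "(cmod (cayley (f w) (f z)))\<^sup>2 \<le> (cmod (cayley w z))\<^sup>2"
    by (simp add: power_mono)
  then have le: "(cmod (f z - f w))\<^sup>2 / ((cmod (f z - f w))\<^sup>2 + 4 * Im (f z) * Im (f w))
      \<le> (cmod (z - w))\<^sup>2 / ((cmod (z - w))\<^sup>2 + 4 * Im z * Im w)"
    by (simp add: norm_cayley_power2 fpos z w)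
  \<comment> \<open>Cross-multiplication produces \<open>A * B\<close> on both sides; what remains
    is the claim.\<close>
  have "A * (c * d) \<le> B * (a * b)"
    if "A / (A + 4 * a * b) \<le> B / (B + 4 * c * d)" "A \<ge> 0" "B \<ge> 0" "a > 0" "b > 0" "c > 0" "d > 0"
    for A B a b c d :: real
  proof -
    have p: "A + 4 * a * b > 0" "B + 4 * c * d > 0"
      using that by (simp_all add: add_nonneg_pos)
    have "A * (B + 4 * c * d) \<le> B * (A + 4 * a * b)"
      using that(1) p by (simp add: divide_le_eq le_divide_eq pos_divide_le_eq pos_le_divide_eq mult.commute)
    then show ?thesis by (simp add: algebra_simps)
  qed
  from this[OF le] show ?thesis using fpos z w by simp
qed

text \<open>Equality case of Schwarz's lemma: the conjugated map is a rotation, and its factor is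
  \<open>deriv f w\<close>, since the derivatives of the two Cayley maps are reciprocal.\<close>

lemma fixed_point_deriv_1_imp_identity:
  assumes hol: "f holomorphic_on upper_half" and im: "\<And>z. Im z > 0 \<Longrightarrow> Im (f z) > 0"
    and w: "Im w > 0" and fw: "f w = w" and d1: "deriv f w = 1" and z: "Im z > 0"
  shows "f z = z"
proof -
  define h where "h \<zeta> = cayley (f w) (f (cayley_inv w \<zeta>))" for \<zeta>
  have c0: "cayley_inv w 0 = w" by (simp add: cayley_inv_def)
  have h0: "h 0 = 0" by (simp add: h_def cayley_def cayley_inv_def)
  have ne: "w - cnj w \<noteq> 0" using w by (auto simp: complex_eq_iff)
  have 1: "(cayley_inv w has_field_derivative (w - cnj w)) (at 0)"
    unfolding cayley_inv_def by (auto intro!: derivative_eq_intros simp: algebra_simps)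
  have "f field_differentiable at w"
    using hol open_upper_half w by (meson holomorphic_on_imp_differentiable_at mem_upper_half)
  then have 2: "(f has_field_derivative 1) (at (cayley_inv w 0))"
    using d1 by (simp add: DERIV_deriv_iff_field_differentiable c0 flip: d1)
  have 3: "(cayley w has_field_derivative inverse (w - cnj w)) (at (f (cayley_inv w 0)))"
    unfolding cayley_def c0 fw by (rule derivative_eq_intros refl ne)+ (use ne in \<open>simp add: divide_inverse\<close>)
  have "(h has_field_derivative inverse (w - cnj w) * (1 * (w - cnj w))) (at 0)"
    unfolding h_def fw
    by (rule DERIV_chain2[of "cayley w", OF 3 DERIV_chain2[of f, OF 2 1]])
  then have hd: "(h has_field_derivative 1) (at 0)" using ne by simp
  then have "deriv h 0 = 1" by (rule DERIV_imp_deriv)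
  then have "\<exists>\<alpha>. (\<forall>z. cmod z < 1 \<longrightarrow> h z = \<alpha> * z) \<and> cmod \<alpha> = 1"
    using Schwarz_Lemma'[of h] h0 holomorphic_cayley_conj[OF hol im w] unfolding h_def by simp
  then obtain \<alpha> where \<alpha>: "\<And>z. cmod z < 1 \<Longrightarrow> h z = \<alpha> * z" by blast
  have "((\<lambda>z. \<alpha> * z) has_field_derivative 1) (at 0)"
    by (rule has_field_derivative_transform_within_open[OF hd, of "ball 0 1"]) (auto simp: \<alpha>)
  moreover have "((\<lambda>z. \<alpha> * z) has_field_derivative \<alpha>) (at 0)"
    by (auto intro!: derivative_eq_intros)
  ultimately have "\<alpha> = 1" using DERIV_unique by blast
  then have "cayley w (f z) = cayley w z"
    using \<alpha>[OF norm_cayley_less_1[OF z w]] by (simp add: h_def cayley_inv_cayley z w fw)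
  then show ?thesis
    using cayley_inv_cayley[OF z w] cayley_inv_cayley[OF im[OF z] w] by simp
qed

section \<open>Fixed points of half-plane maps depending on a shift\<close>

text \<open>\<open>k\<close> stands for \<phi> o F_\<nu>. Strictness in \<open>Im_neg\<close> keeps
  \<open>z - k w\<close> in the open half-plane even for real \<open>z\<close>;
  \<open>growth\<close> prevents this map from being the identity and from pushing fixed points to
  infinity.\<close>

locale pick_shift =
  fixes k :: "complex \<Rightarrow> complex"
  assumes hol_k: "k holomorphic_on upper_half"
    and Im_neg: "Im w > 0 \<Longrightarrow> Im (k w) < 0"
    and growth: "((\<lambda>Y::real. k (\<i> * of_real Y) / of_real Y) \<longlongrightarrow> 0) at_top"
begin

lemma schwarz_pick_shift:
  assumes "Im z \<ge> 0" "Im v > 0" "Im w > 0"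
  shows "(cmod ((z - k v) - (z - k w)))\<^sup>2 * (Im v * Im w)
    \<le> (cmod (v - w))\<^sup>2 * (Im (z - k v) * Im (z - k w))"
proof (rule schwarz_pick_upper_half)
  show "(\<lambda>w. z - k w) holomorphic_on upper_half"
    by (intro holomorphic_intros hol_k)
  show "Im (z - k u) > 0" if "Im u > 0" for u
    using Im_neg[OF that] assms(1) by simp
qed (use assms in auto)

lemma cont: "continuous_on upper_half k"
  using hol_k by (rule holomorphic_on_imp_continuous_on)

text \<open>
  Since \<open>f w = z - k w\<close> moves \<open>\<i> Y\<close> down to height at most \<open>Y / 2\<close>, a fixed point of \<open>f\<close> is
  hyperbolically closer to \<open>f (\<i> Y)\<close> than to \<open>\<i> Y\<close>, hence lies in a Euclidean disc.
\<close>
lemma solutions_bounded: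
  obtains B where "\<And>z w. cmod z \<le> R \<Longrightarrow> Im z \<ge> 0 \<Longrightarrow> Im w > 0 \<Longrightarrow> w + k w = z \<Longrightarrow> cmod w \<le> B"
proof -
  have "\<forall>\<^sub>F Y in at_top. cmod (k (\<i> * of_real Y) / of_real Y) < 1 / 4"
    using tendstoD[OF growth, of "1/4"] by (simp add: dist_norm)
  moreover have "\<forall>\<^sub>F Y in at_top. Y > max 0 (4 * R)" by (rule eventually_gt_at_top)
  ultimately have "\<forall>\<^sub>F Y in at_top. Y > max 0 (4 * R) \<and> cmod (k (\<i> * of_real Y) / of_real Y) < 1 / 4"
    by eventually_elim simp
  \<comment> \<open>The choices \<open>1 / 4\<close> and \<open>Y > 4 * R\<close> together give |z -
    k(\<i> Y)| \<le> R + Y / 4 \<le> Y / 2.\<close>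
  from eventually_happens'[OF trivial_limit_at_top_linorder this]
  obtain Y :: real where "Y > max 0 (4 * R)" and kq: "cmod (k (\<i> * of_real Y) / of_real Y) < 1 / 4"
    by blast
  then have Y: "Y > 0" "4 * R < Y" by auto
  have kY: "cmod (k (\<i> * of_real Y)) < Y / 4"
    using kq Y by (simp add: norm_divide field_simps)
  show ?thesis
  proof (rule that[of "5 * Y"])
    fix z w assume z: "cmod z \<le> R" "Im z \<ge> 0" and w: "Im w > 0" "w + k w = z"
    define p where "p = z - k (\<i> * of_real Y)"
    have fw: "z - k w = w" using w(2) by (simp add: algebra_simps)
    have "cmod p \<le> cmod z + cmod (k (\<i> * of_real Y))"
      unfolding p_def by (rule norm_triangle_ineq4)
    then have pY: "cmod p \<le> Y / 2" using z kY Y by linarith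
    have Imp: "Im p > 0"
      using Im_neg[of "\<i> * of_real Y"] Y z unfolding p_def by simp
    have "Im p \<le> Y / 2" using pY abs_Im_le_cmod[of p] by linarith
    have "(cmod (w - p))\<^sup>2 * (Im w * Y) \<le> (cmod (w - \<i> * of_real Y))\<^sup>2 * (Im w * Im p)"
      using schwarz_pick_shift[of z w "\<i> * of_real Y"] z w Y fw by (simp add: p_def)
    then have "Im w * ((cmod (w - p))\<^sup>2 * Y) \<le> Im w * ((cmod (w - \<i> * of_real Y))\<^sup>2 * Im p)"
      by (simp add: algebra_simps)
    then have "(cmod (w - p))\<^sup>2 * Y \<le> (cmod (w - \<i> * of_real Y))\<^sup>2 * Im p"
      using w by simp
    also have "\<dots> \<le> (cmod (w - \<i> * of_real Y))\<^sup>2 * (Y / 2)"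
      by (rule mult_left_mono) (use \<open>Im p \<le> Y / 2\<close> in auto)
    finally have "Y * (cmod (w - p))\<^sup>2 \<le> Y * ((cmod (w - \<i> * of_real Y))\<^sup>2 / 2)"
      by (simp add: algebra_simps)
    then have "(cmod (w - p))\<^sup>2 \<le> (cmod (w - \<i> * of_real Y))\<^sup>2 / 2"
      using Y by simp
    \<comment> \<open>As 1/2 < (3/4)^2, this is a rational contraction factor; with
      \<open>cmod p \<le> Y / 2\<close> it yields |w| - Y / 2 \<le> 3/4 * (|w| + Y), that is |w|
      \<le> 5 Y.\<close>
    also have "\<dots> \<le> (3 / 4 * cmod (w - \<i> * of_real Y))\<^sup>2"
      by (simp add: power2_eq_square)
    finally have "cmod (w - p) \<le> 3 / 4 * cmod (w - \<i> * of_real Y)"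
      by (rule power2_le_imp_le) simp
    moreover have "cmod (w - \<i> * of_real Y) \<le> cmod w + Y"
      using norm_triangle_ineq4[of w "\<i> * of_real Y"] Y by (simp add: norm_mult)
    moreover have "cmod w - cmod p \<le> cmod (w - p)" by (rule norm_triangle_ineq2)
    ultimately show "cmod w \<le> 5 * Y" using pY by linarith
  qed
qed

text \<open>Injectivity of \<open>w + k w\<close> over the open half-plane. Positive height of the
  common value leaves room to lower the self-map without leaving the half-plane.\<close>

lemma solution_unique:
  assumes "Im v > 0" "Im w > 0" "v + k v = w + k w" "Im (w + k w) > 0"
  shows "v = w"
proof (rule ccontr)
  assume ne: "v \<noteq> w"
  define z where "z = w + k w"
  \<comment> \<open>Schwarz-Pick applied to the smaller map \<open>f - \<i> \<delta>\<close> makes the inequality strict.\<close>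
  define \<delta> where "\<delta> = Im z"
  have d: "\<delta> > 0" using assms by (simp add: \<delta>_def z_def)
  have fv: "z - k v = v" and fw: "z - k w = w"
    using assms by (auto simp: z_def algebra_simps)
  have e: "of_real (Re z) - k u = (z - k u) - \<i> * of_real \<delta>" for u
    by (simp add: \<delta>_def complex_eq_iff)
  have "(cmod (v - w))\<^sup>2 * (Im v * Im w) \<le> (cmod (v - w))\<^sup>2 * ((Im v - \<delta>) * (Im w - \<delta>))"
    using schwarz_pick_shift[of "of_real (Re z)" v w] assms(1,2) unfolding e fv fw by simp
  then have le: "Im v * Im w \<le> (Im v - \<delta>) * (Im w - \<delta>)" using ne by simp
  have "Im v > \<delta>" "Im w > \<delta>"
    using Im_neg[OF assms(1)] Im_neg[OF assms(2)] arg_cong[OF fv, of Im] arg_cong[OF fw, of Im]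
    by (auto simp: \<delta>_def)
  then have "(Im v - \<delta>) * (Im w - \<delta>) < Im v * Im w"
    using d by (intro mult_strict_mono) auto
  with le show False by simp
qed

text \<open>Keeps limits of solutions off the real axis as long as the targets stay at positive
  height.\<close>

lemma Im_solution: "Im w > 0 \<Longrightarrow> w + k w = z \<Longrightarrow> Im z < Im w"
  using Im_neg[of w] by auto

lemma solution_domain:
  defines "\<Omega> \<equiv> {w \<in> upper_half. w + k w \<in> upper_half}"
  shows "open \<Omega>" "inj_on (\<lambda>w. w + k w) \<Omega>" "(\<lambda>w. w + k w) holomorphic_on \<Omega>"
proof -
  have cP: "continuous_on upper_half (\<lambda>w. w + k w)" by (intro continuous_intros cont)
  have "openin (top_of_set upper_half) (upper_half \<inter> (\<lambda>w. w + k w) -` upper_half)"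
    using cP open_upper_half continuous_openin_preimage_gen by blast
  moreover have "upper_half \<inter> (\<lambda>w. w + k w) -` upper_half = \<Omega>" by (auto simp: \<Omega>_def)
  ultimately show "open \<Omega>" using open_upper_half openin_open_eq by metis
  show "inj_on (\<lambda>w. w + k w) \<Omega>"
    by (rule inj_onI, rule solution_unique) (auto simp: \<Omega>_def)
  show "(\<lambda>w. w + k w) holomorphic_on \<Omega>"
    by (intro holomorphic_intros holomorphic_on_subset[OF hol_k]) (auto simp: \<Omega>_def)
qed

text \<open>A connectedness argument: the set of attained \<open>z\<close> is open by the open
  mapping theorem, relatively closed because solutions stay bounded and above their targets, and
  non-empty by \<open>growth\<close>.\<close>

lemma solution_exists:
  assumes "Im z > 0"
  obtains w where "Im w > 0" "w + k w = z"
proof -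
  define \<Omega> where "\<Omega> = {w \<in> upper_half. w + k w \<in> upper_half}"
  define A where "A = (\<lambda>w. w + k w) ` \<Omega>"
  have cP: "continuous_on upper_half (\<lambda>w. w + k w)" by (intro continuous_intros cont)
  have "open A"
    unfolding A_def \<Omega>_def using solution_domain open_mapping_thm3 by blast
  moreover have AS: "A \<subseteq> upper_half" by (auto simp: A_def \<Omega>_def)
  ultimately have 1: "openin (top_of_set upper_half) A"
    by (simp add: openin_open_eq[OF open_upper_half])
  have "u \<in> A" if "u \<in> closure A" "u \<in> upper_half" for u
  proof -
    from that(1) obtain zs where zs: "\<And>n. zs n \<in> A" "zs \<longlonglongrightarrow> u"
      unfolding closure_sequential by blast
    have "\<exists>w. w \<in> \<Omega> \<and> w + k w = zs n" for n
      using zs(1)[of n] by (auto simp: A_def)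
    then obtain w where w: "\<And>n. w n \<in> \<Omega>" "\<And>n. w n + k (w n) = zs n" by metis
    have wp: "Im (w n) > 0" "Im (zs n) > 0" for n
      using w(1)[of n] by (auto simp: \<Omega>_def simp flip: w(2))
    from zs(2) have "bounded (range zs)" by (rule convergent_imp_bounded)
    then obtain R where R: "\<And>n. cmod (zs n) \<le> R" unfolding bounded_iff by auto
    obtain B where B: "\<And>z w. cmod z \<le> R \<Longrightarrow> Im z \<ge> 0 \<Longrightarrow> Im w > 0 \<Longrightarrow> w + k w = z \<Longrightarrow> cmod w \<le> B"
      using solutions_bounded by blast
    have "cmod (w n) \<le> B" for n using B[OF R _ _ w(2)] wp[of n] by simp
    then have "bounded (range w)" unfolding bounded_iff by auto
    then obtain l r where lr: "strict_mono r" "(w \<circ> r) \<longlonglongrightarrow> l"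
      using bounded_imp_convergent_subsequence by blast
    have zr: "(\<lambda>n. zs (r n)) \<longlonglongrightarrow> u" using zs(2) lr(1) LIMSEQ_subseq_LIMSEQ by (auto simp: o_def)
    have wr: "(\<lambda>n. w (r n)) \<longlonglongrightarrow> l" using lr(2) by (simp add: o_def)
    have "Im u \<le> Im l"
      using tendsto_Im[OF zr] tendsto_Im[OF wr]
      by (rule LIMSEQ_le) (use Im_solution[OF wp(1) w(2)] less_imp_le in blast)
    then have lp: "Im l > 0" using that(2) by simp
    have "isCont (\<lambda>w. w + k w) l"
      using cP open_upper_half lp by (simp add: continuous_on_eq_continuous_at)
    then have "(\<lambda>n. w (r n) + k (w (r n))) \<longlonglongrightarrow> l + k l"
      by (rule isCont_tendsto_compose[OF _ wr])
    then have "l + k l = u" using zr LIMSEQ_unique by (simp add: w(2))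
    then show ?thesis using lp that(2) by (auto simp: A_def \<Omega>_def)
  qed
  then have "A = upper_half \<inter> closure A" using AS closure_subset by blast
  then have 2: "closedin (top_of_set upper_half) A" unfolding closedin_closed by blast
  have "\<forall>\<^sub>F Y in at_top. cmod (k (\<i> * of_real Y) / of_real Y) < 1"
    using tendstoD[OF growth, of 1] by (simp add: dist_norm)
  then have "\<forall>\<^sub>F Y in at_top. Y > 0 \<and> cmod (k (\<i> * of_real Y) / of_real Y) < 1"
    using eventually_gt_at_top[of 0] by eventually_elim simp
  from eventually_happens'[OF trivial_limit_at_top_linorder this]
  obtain Y :: real where Y: "Y > 0" "cmod (k (\<i> * of_real Y) / of_real Y) < 1"
    by blast
  then have "cmod (k (\<i> * of_real Y)) < Y" by (simp add: norm_divide)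
  then have "Im (\<i> * of_real Y + k (\<i> * of_real Y)) > 0"
    using abs_Im_le_cmod[of "k (\<i> * of_real Y)"] by simp
  then have "\<i> * of_real Y \<in> \<Omega>" using Y by (simp add: \<Omega>_def)
  then have "A \<noteq> {}" by (auto simp: A_def)
  then have "A = upper_half"
    using connected_upper_half 1 2 unfolding connected_clopen by blast
  then have "z \<in> A" using assms by simp
  then show ?thesis using that by (auto simp: A_def \<Omega>_def)
qed

text \<open>Stated as a left inverse because later arguments produce the point \<open>w\<close>
  first and then evaluate \<omega> at its image.\<close>

lemma holomorphic_solution:
  obtains \<omega> where "\<omega> holomorphic_on upper_half" "\<And>z. Im z > 0 \<Longrightarrow> Im (\<omega> z) > 0"
    "\<And>w. Im w > 0 \<Longrightarrow> Im (w + k w) > 0 \<Longrightarrow> \<omega> (w + k w) = w"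
proof -
  define \<Omega> where "\<Omega> = {w \<in> upper_half. w + k w \<in> upper_half}"
  have im: "(\<lambda>w. w + k w) ` \<Omega> = upper_half"
  proof
    show "upper_half \<subseteq> (\<lambda>w. w + k w) ` \<Omega>"
    proof
      fix z assume "z \<in> upper_half"
      then obtain w where "Im w > 0" "w + k w = z" using solution_exists by auto
      then show "z \<in> (\<lambda>w. w + k w) ` \<Omega>" using \<open>z \<in> upper_half\<close> by (auto simp: \<Omega>_def)
    qed
  qed (auto simp: \<Omega>_def)
  show ?thesis
  proof (rule holomorphic_has_inverse[OF solution_domain(3,1,2), folded \<Omega>_def])
    fix g assume g: "g holomorphic_on (\<lambda>w. w + k w) ` \<Omega>" "\<And>w. w \<in> \<Omega> \<Longrightarrow> g (w + k w) = w"
    have *: "g (w + k w) = w" if "Im w > 0" "Im (w + k w) > 0" for w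
      using g(2)[of w] that by (simp add: \<Omega>_def)
    show ?thesis
    proof (rule that[of g])
      show "g holomorphic_on upper_half" using g(1) by (simp only: im)
      show "Im (g z) > 0" if z: "Im z > 0" for z
        using solution_exists[OF z] * z by metis
    qed (rule *)
  qed
qed

text \<open>
  In the second case \<open>a\<close> is a real limit of solutions for \<open>z = x + \<i> / n\<close>; the inequality says
  that \<open>w \<mapsto> x - k w\<close> maps horodiscs at \<open>a\<close> into themselves.
\<close>
lemma real_solution_or_julia:
  fixes x :: real
  obtains w where "Im w > 0" "w + k w = of_real x"
  | a :: real where "\<And>w. Im w > 0 \<Longrightarrow>
      (cmod (of_real x - k w - of_real a))\<^sup>2 * Im w \<le> (cmod (w - of_real a))\<^sup>2 * Im (- k w)"
proof -
  define z :: "nat \<Rightarrow> complex" where "z n = Complex x (1 / Suc n)" for n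
  have z: "z \<longlonglongrightarrow> of_real x"
  proof -
    have "(\<lambda>n. Complex x (1 / Suc n)) \<longlonglongrightarrow> Complex x 0"
      by (intro tendsto_Complex tendsto_const) (use LIMSEQ_inverse_real_of_nat in \<open>simp add: inverse_eq_divide\<close>)
    then show ?thesis by (simp add: z_def[abs_def] complex_of_real_def)
  qed
  have zp: "Im (z n) > 0" for n by (simp add: z_def)
  have "\<exists>w. Im w > 0 \<and> w + k w = z n" for n using solution_exists[OF zp] by metis
  then obtain w where w: "\<And>n. Im (w n) > 0" "\<And>n. w n + k (w n) = z n" by metis
  from z have "bounded (range z)" by (rule convergent_imp_bounded)
  then obtain R where R: "\<And>n. cmod (z n) \<le> R" unfolding bounded_iff by auto
  obtain B where B: "\<And>z w. cmod z \<le> R \<Longrightarrow> Im z \<ge> 0 \<Longrightarrow> Im w > 0 \<Longrightarrow> w + k w = z \<Longrightarrow> cmod w \<le> B"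
    using solutions_bounded by blast
  have "cmod (w n) \<le> B" for n using B[OF R _ w(1) w(2)] zp[of n] by simp
  then have "bounded (range w)" unfolding bounded_iff by auto
  then obtain l r where lr: "strict_mono r" "(w \<circ> r) \<longlonglongrightarrow> l"
    using bounded_imp_convergent_subsequence by blast
  have zr: "(\<lambda>n. z (r n)) \<longlonglongrightarrow> of_real x" using z lr(1) LIMSEQ_subseq_LIMSEQ by (auto simp: o_def)
  have wr: "(\<lambda>n. w (r n)) \<longlonglongrightarrow> l" using lr(2) by (simp add: o_def)
  have "Im l \<ge> 0"
    using tendsto_Im[OF wr] by (rule LIMSEQ_le_const) (use w(1) less_imp_le in blast)
  show ?thesis
  proof (cases "Im l > 0")
    case True
    then have "isCont (\<lambda>w. w + k w) l"
      using cont open_upper_half by (auto simp: continuous_on_eq_continuous_at intro!: continuous_intros)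
    then have "(\<lambda>n. w (r n) + k (w (r n))) \<longlonglongrightarrow> l + k l"
      by (rule isCont_tendsto_compose[OF _ wr])
    then have "l + k l = of_real x" using zr LIMSEQ_unique by (simp add: w(2))
    with True show ?thesis using that(1) by blast
  next
    case False
    then have l: "l = of_real (Re l)" using \<open>Im l \<ge> 0\<close> by (simp add: complex_eq_iff)
    show ?thesis
    proof (rule that(2))
      fix v assume v: "Im v > 0"
      have "(cmod (z n - k v - w n))\<^sup>2 * Im v \<le> (cmod (v - w n))\<^sup>2 * Im (z n - k v)" for n
      proof -
        have fw: "z n - k (w n) = w n" using w(2)[of n] by (simp add: algebra_simps)
        \<comment> \<open>Since \<open>w n\<close> is a fixed point, its height occurs on both sides
          and cancels; what is left survives \<open>Im (w n)\<close> tending to 0.\<close>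
        have "Im (w n) * ((cmod (z n - k v - w n))\<^sup>2 * Im v) \<le> Im (w n) * ((cmod (v - w n))\<^sup>2 * Im (z n - k v))"
          using schwarz_pick_shift[of "z n" v "w n"] v w(1)[of n] zp[of n] unfolding fw
          by (simp add: algebra_simps)
        then show ?thesis using w(1)[of n] by simp
      qed
      then have le: "(cmod (z (r n) - k v - w (r n)))\<^sup>2 * Im v \<le> (cmod (v - w (r n)))\<^sup>2 * Im (z (r n) - k v)" for n
        by blast
      have "(cmod (of_real x - k v - l))\<^sup>2 * Im v \<le> (cmod (v - l))\<^sup>2 * Im (of_real x - k v)"
      proof (rule LIMSEQ_le)
        show "(\<lambda>n. (cmod (z (r n) - k v - w (r n)))\<^sup>2 * Im v) \<longlonglongrightarrow> (cmod (of_real x - k v - l))\<^sup>2 * Im v"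
          by (intro tendsto_intros zr wr)
        show "(\<lambda>n. (cmod (v - w (r n)))\<^sup>2 * Im (z (r n) - k v)) \<longlonglongrightarrow> (cmod (v - l))\<^sup>2 * Im (of_real x - k v)"
          by (intro tendsto_intros zr wr)
      qed (use le in blast)
      then show "(cmod (of_real x - k v - of_real (Re l)))\<^sup>2 * Im v \<le> (cmod (v - of_real (Re l)))\<^sup>2 * Im (- k v)"
        using l by simp
    qed
  qed
qed

text \<open>A critical point would give \<open>x - k v\<close> derivative 1 at its fixed point
  \<open>w\<close>, hence make it the identity; then \<open>k (\<i> * Y) / Y\<close> would tend to
  \<open>- \<i>\<close> instead of 0. Used for local invertibility over real points.\<close>

lemma deriv_nonzero_at_real_solution:
  assumes w: "Im w > 0" "w + k w = of_real x"
  shows "deriv (\<lambda>w. w + k w) w \<noteq> 0"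
proof
  assume d: "deriv (\<lambda>w. w + k w) w = 0"
  have kd: "k field_differentiable at w"
    using hol_k open_upper_half w by (meson holomorphic_on_imp_differentiable_at mem_upper_half)
  then have "deriv (\<lambda>w. w + k w) w = 1 + deriv k w"
    by (simp add: deriv_add)
  moreover have "deriv (\<lambda>v. of_real x - k v) w = - deriv k w"
    using kd by simp
  ultimately have d1: "deriv (\<lambda>v. of_real x - k v) w = 1" using d
    by (metis add_eq_0_iff minus_minus)
  have id: "of_real x - k v = v" if "Im v > 0" for v
  proof (rule fixed_point_deriv_1_imp_identity[OF _ _ w(1) _ d1 that])
    show "(\<lambda>v. of_real x - k v) holomorphic_on upper_half" by (intro holomorphic_intros hol_k)
  qed (use w Im_neg in \<open>auto simp: algebra_simps\<close>)
  have "k (\<i> * of_real Y) / of_real Y = of_real (x / Y) - \<i>" if "Y > 0" for Y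
    using id[of "\<i> * of_real Y"] that by (simp add: field_simps)
  then have "\<forall>\<^sub>F Y in at_top. k (\<i> * of_real Y) / of_real Y = of_real (x / Y) - \<i>"
    using eventually_gt_at_top[of "0::real"] by (rule eventually_mono[rotated]) blast
  from tendsto_cong[OF this] growth have "((\<lambda>Y. of_real (x / Y) - \<i>) \<longlongrightarrow> 0) at_top" by simp
  moreover have "((\<lambda>Y. of_real (x / Y) - \<i>) \<longlongrightarrow> of_real 0 - \<i>) at_top"
    by (intro tendsto_intros real_tendsto_divide_at_top[OF tendsto_const] filterlim_ident)
  ultimately have "of_real 0 - \<i> = 0" using tendsto_unique trivial_limit_at_top_linorder by blast
  then show False by simp
qed

end

section \<open>Cauchy transforms\<close>

lemma borel_prob_measurable:
  assumes "borel_prob \<mu>" "f \<in> borel_measurable borel"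
  shows "f \<in> borel_measurable \<mu>"
  using assms measurable_cong_sets[of \<mu> borel borel borel] by (auto simp: borel_prob_def)

lemma borel_prob_integrable_bounded:
  fixes f :: "real \<Rightarrow> 'a :: {banach, second_countable_topology}"
  assumes "borel_prob \<mu>" "f \<in> borel_measurable borel" "\<And>t. norm (f t) \<le> B"
  shows "integrable \<mu> f"
proof -
  interpret prob_space \<mu> using assms by (simp add: borel_prob_def)
  show ?thesis
    by (rule integrable_const_bound[of _ B]) (use assms borel_prob_measurable in auto)
qed

lemma norm_minus_of_real_ge_Im: "Im z \<le> cmod (z - of_real t)"
  using abs_Im_le_cmod[of "z - of_real t"] by simp

lemma minus_of_real_nonzero: "Im z > 0 \<Longrightarrow> z - of_real t \<noteq> 0"
  by (auto simp: complex_eq_iff)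

lemma inverse_minus_measurable [measurable]:
  "(\<lambda>t. inverse (z - complex_of_real t)) \<in> borel_measurable borel"
  by measurable

lemma norm_inverse_minus_le:
  assumes "Im z > 0"
  shows "cmod (inverse (z - of_real t)) \<le> 1 / Im z"
  using norm_minus_of_real_ge_Im[of z t] assms
  by (simp add: norm_inverse frac_le flip: inverse_eq_divide) (simp add: le_imp_inverse_le)

lemma cauchy_integrable:
  assumes "borel_prob \<mu>" "Im z > 0"
  shows "integrable \<mu> (\<lambda>t. inverse (z - complex_of_real t))"
  by (rule borel_prob_integrable_bounded[OF assms(1), where B = "1 / Im z"])
     (use norm_inverse_minus_le assms in auto)

lemma cauchy_square_integrable:
  assumes "borel_prob \<mu>" "Im z > 0"
  shows "integrable \<mu> (\<lambda>t. (inverse (z - complex_of_real t))\<^sup>2)"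
proof (rule borel_prob_integrable_bounded[OF assms(1), where B = "(1 / Im z)\<^sup>2"])
  show "cmod ((inverse (z - complex_of_real t))\<^sup>2) \<le> (1 / Im z)\<^sup>2" for t
    unfolding norm_power by (intro power_mono norm_inverse_minus_le assms norm_ge_zero)
qed auto

text \<open>For each \<open>t\<close> the difference quotient of the kernel misses its derivative by
  (z - w) * inverse (z - t) * (inverse (w - t))^2, bounded uniformly in \<open>t\<close>;
  integration gives an explicit error of order |z - w|.\<close>

lemma cauchy_transform_has_derivative:
  assumes \<mu>: "borel_prob \<mu>" and w: "Im w > 0"
  shows "(cauchy_transform \<mu> has_field_derivative - (\<integral>t. (inverse (w - complex_of_real t))\<^sup>2 \<partial>\<mu>)) (at w)"
proof -
  interpret prob_space \<mu> using \<mu> by (simp add: borel_prob_def)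
  define D where "D = - (\<integral>t. (inverse (w - complex_of_real t))\<^sup>2 \<partial>\<mu>)"
  \<comment> \<open>For |z - w| < Im w / 2 the height of \<open>z\<close> exceeds Im w / 2, so the
    kernels contribute the factors 2 / Im w and (1 / Im w)^2.\<close>
  define C where "C = 2 / Im w ^ 3"
  have bound: "cmod ((cauchy_transform \<mu> z - cauchy_transform \<mu> w) / (z - w) - D) \<le> C * cmod (z - w)"
    if z: "z \<noteq> w" "cmod (z - w) < Im w / 2" for z
  proof -
    have Imz: "Im z > Im w / 2"
      using abs_Im_le_cmod[of "z - w"] z by auto
    then have Imz0: "Im z > 0" using w by simp
    have i1: "integrable \<mu> (\<lambda>t. (inverse (z - of_real t) - inverse (w - of_real t)) / (z - w))"
      using cauchy_integrable[OF \<mu>] w Imz0 by simp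
    have "(cauchy_transform \<mu> z - cauchy_transform \<mu> w) / (z - w) - D =
        (\<integral>t. (inverse (z - of_real t) - inverse (w - of_real t)) / (z - w) + (inverse (w - complex_of_real t))\<^sup>2 \<partial>\<mu>)"
      unfolding D_def cauchy_transform_def
      using cauchy_integrable[OF \<mu>] w Imz0 cauchy_square_integrable[OF \<mu> w] i1
      by (simp add: Bochner_Integration.integral_diff)
    also have "cmod \<dots> \<le> (\<integral>t. C * cmod (z - w) \<partial>\<mu>)"
    proof (rule Bochner_Integration.integral_norm_bound_integral)
      show "integrable \<mu> (\<lambda>t. (inverse (z - of_real t) - inverse (w - of_real t)) / (z - w) + (inverse (w - complex_of_real t))\<^sup>2)"
        using i1 cauchy_square_integrable[OF \<mu> w] by simp
      fix t
      have n: "z - of_real t \<noteq> 0" "w - of_real t \<noteq> 0" "z - w \<noteq> 0"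
        using minus_of_real_nonzero Imz0 w z by auto
      have "(inverse a - inverse b) / (a - b) + (inverse b)\<^sup>2 = (a - b) * (inverse a * (inverse b)\<^sup>2)"
        if "a \<noteq> 0" "b \<noteq> 0" "a - b \<noteq> 0" for a b :: complex
        using that by (simp add: field_simps power2_eq_square)
      from this[of "z - of_real t" "w - of_real t"] n
      have "(inverse (z - of_real t) - inverse (w - of_real t)) / (z - w) + (inverse (w - complex_of_real t))\<^sup>2
         = (z - w) * (inverse (z - of_real t) * (inverse (w - of_real t))\<^sup>2)" by simp
      also have "cmod \<dots> = cmod (z - w) * (cmod (inverse (z - of_real t)) * (cmod (inverse (w - of_real t)))\<^sup>2)"
        by (simp add: norm_mult norm_power)
      also have "\<dots> \<le> cmod (z - w) * ((2 / Im w) * (1 / Im w)\<^sup>2)"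
      proof (intro mult_left_mono mult_mono power_mono norm_inverse_minus_le w norm_ge_zero)
        have "1 / Im z \<le> 2 / Im w" using Imz w by (simp add: field_simps)
        then show "cmod (inverse (z - of_real t)) \<le> 2 / Im w"
          using norm_inverse_minus_le[OF Imz0, of t] by linarith
      qed (use w in auto)
      finally show "cmod ((inverse (z - of_real t) - inverse (w - of_real t)) / (z - w) + (inverse (w - complex_of_real t))\<^sup>2) \<le> C * cmod (z - w)"
        by (simp add: C_def power2_eq_square power3_eq_cube mult.commute)
    qed simp
    also have "\<dots> = C * cmod (z - w)" by (simp add: prob_space)
    finally show ?thesis .
  qed
  have ev: "\<forall>\<^sub>F z in at w. cmod ((cauchy_transform \<mu> z - cauchy_transform \<mu> w) / (z - w) - D) \<le> C * cmod (z - w)"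
    unfolding eventually_at using bound w
    by (intro exI[of _ "Im w / 2"]) (auto simp: dist_norm)
  have "((\<lambda>z. C * cmod (z - w)) \<longlongrightarrow> C * cmod (w - w)) (at w)"
    by (intro tendsto_intros)
  then have "((\<lambda>z. C * cmod (z - w)) \<longlongrightarrow> 0) (at w)" by simp
  then have "((\<lambda>z. (cauchy_transform \<mu> z - cauchy_transform \<mu> w) / (z - w) - D) \<longlongrightarrow> 0) (at w)"
    by (rule Lim_null_comparison[OF ev])
  then have "((\<lambda>z. (cauchy_transform \<mu> z - cauchy_transform \<mu> w) / (z - w)) \<longlongrightarrow> D) (at w)"
    by (simp add: LIM_zero_iff)
  then show ?thesis by (simp add: has_field_derivative_iff D_def)
qed

lemma cauchy_transform_holomorphic:
  "borel_prob \<mu> \<Longrightarrow> cauchy_transform \<mu> holomorphic_on upper_half"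
  unfolding holomorphic_on_open[OF open_upper_half] using cauchy_transform_has_derivative by fastforce

lemma poisson_integrable:
  assumes "borel_prob \<mu>" "Im z > 0"
  shows "integrable \<mu> (\<lambda>t. 1 / (cmod (z - of_real t))\<^sup>2)"
  using integrable_norm[OF cauchy_square_integrable[OF assms]]
  by (simp add: norm_power norm_inverse power_inverse inverse_eq_divide[symmetric])

lemma Im_cauchy_transform:
  assumes "borel_prob \<mu>" "Im z > 0"
  shows "Im (cauchy_transform \<mu> z) = - Im z * (\<integral>t. 1 / (cmod (z - of_real t))\<^sup>2 \<partial>\<mu>)"
proof -
  have "Im (inverse (z - of_real t)) = - Im z * (1 / (cmod (z - of_real t))\<^sup>2)" for t
    unfolding cmod_power2 by simp
  then show ?thesis
    unfolding cauchy_transform_def integral_Im[OF cauchy_integrable[OF assms], symmetric]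
    by (simp only: integral_mult_right_zero)
qed

lemma integral_inverse_square_pos:
  assumes "borel_prob \<mu>" "Im z > 0"
  shows "(\<integral>t. 1 / (cmod (z - of_real t))\<^sup>2 \<partial>\<mu>) > 0"
proof -
  interpret prob_space \<mu> using assms by (simp add: borel_prob_def)
  have "(\<integral>t. 1 / (cmod (z - of_real t))\<^sup>2 \<partial>\<mu>) \<ge> 0" by simp
  moreover have "(\<integral>t. 1 / (cmod (z - of_real t))\<^sup>2 \<partial>\<mu>) \<noteq> 0"
  proof
    assume "(\<integral>t. 1 / (cmod (z - of_real t))\<^sup>2 \<partial>\<mu>) = 0"
    then have "AE t in \<mu>. 1 / (cmod (z - of_real t))\<^sup>2 = 0"
      by (subst (asm) integral_nonneg_eq_0_iff_AE) (use poisson_integrable[OF assms] in auto)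
    then have "AE t in \<mu>. False"
      by (rule AE_mp) (use minus_of_real_nonzero[OF assms(2)] in auto)
    then show False by simp
  qed
  ultimately show ?thesis by linarith
qed

lemma Im_cauchy_transform_neg:
  assumes "borel_prob \<mu>" "Im z > 0"
  shows "Im (cauchy_transform \<mu> z) < 0"
  using Im_cauchy_transform[OF assms] integral_inverse_square_pos[OF assms] assms by simp

lemma cauchy_transform_nonzero:
  assumes "borel_prob \<mu>" "Im z > 0"
  shows "cauchy_transform \<mu> z \<noteq> 0"
  using Im_cauchy_transform_neg[OF assms] by auto

lemma F_transform_holomorphic:
  assumes "borel_prob \<mu>"
  shows "F_transform \<mu> holomorphic_on upper_half"
  unfolding F_transform_def
  by (intro holomorphic_intros cauchy_transform_holomorphic assms)
     (use cauchy_transform_nonzero assms in auto)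

text \<open>Jensen's inequality, in the form that the variance of |1 / (z - t)| is
  nonnegative.\<close>

lemma norm_cauchy_transform_power2_le:
  assumes "borel_prob \<mu>" "Im z > 0"
  shows "(cmod (cauchy_transform \<mu> z))\<^sup>2 \<le> (\<integral>t. 1 / (cmod (z - of_real t))\<^sup>2 \<partial>\<mu>)"
proof -
  interpret prob_space \<mu> using assms by (simp add: borel_prob_def)
  define X where "X t = cmod (inverse (z - of_real t))" for t
  have X2: "(X t)\<^sup>2 = 1 / (cmod (z - of_real t))\<^sup>2" for t
    by (simp add: X_def norm_inverse power_inverse inverse_eq_divide[symmetric])
  have i: "integrable \<mu> X" unfolding X_def using cauchy_integrable[OF assms] by simp
  have i2: "integrable \<mu> (\<lambda>t. (X t)\<^sup>2)" unfolding X2 by (rule poisson_integrable[OF assms])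
  have "cmod (cauchy_transform \<mu> z) \<le> expectation X"
    unfolding cauchy_transform_def X_def by (rule integral_norm_bound)
  then have "(cmod (cauchy_transform \<mu> z))\<^sup>2 \<le> (expectation X)\<^sup>2" by (simp add: power_mono)
  also have "\<dots> \<le> expectation (\<lambda>t. (X t)\<^sup>2)"
    using variance_eq[OF i i2] variance_positive[of X] by linarith
  finally show ?thesis by (simp add: X2)
qed

lemma Im_F_transform:
  "Im (F_transform \<mu> z) = - Im (cauchy_transform \<mu> z) / (cmod (cauchy_transform \<mu> z))\<^sup>2"
  by (simp add: F_transform_def cmod_power2 flip: inverse_eq_divide)

text \<open>By the Poisson form of Im G, the quotient Im F / Im z is the second moment of |1 / (z -
  t)| divided by |G|^2, which is at least 1.\<close>

lemma Im_F_transform_ge: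
  assumes "borel_prob \<mu>" "Im z > 0"
  shows "Im (F_transform \<mu> z) \<ge> Im z"
proof -
  have "(cmod (cauchy_transform \<mu> z))\<^sup>2 > 0" using cauchy_transform_nonzero[OF assms] by simp
  moreover have "Im z * (cmod (cauchy_transform \<mu> z))\<^sup>2 \<le> - Im (cauchy_transform \<mu> z)"
    unfolding Im_cauchy_transform[OF assms]
    using norm_cauchy_transform_power2_le[OF assms] assms(2) by simp
  ultimately show ?thesis
    by (simp only: Im_F_transform pos_le_divide_eq)
qed

text \<open>The integral of 1 / |z - t|^2 grows as z descends vertically, so - Im G \<ge> c * y with
  c its value at height 1; division by |G|^2 gives the claim. It supplies Julia's quotient when
  \<open>F_transform\<close> escapes to infinity along the vertical.\<close>

lemma vertical_F_transform_bound:
  assumes \<mu>: "borel_prob \<mu>"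
  obtains C where "C > 0"
    "\<And>y. 0 < y \<Longrightarrow> y \<le> 1 \<Longrightarrow> y * (cmod (F_transform \<mu> (Complex a y)))\<^sup>2 \<le> C * Im (F_transform \<mu> (Complex a y))"
proof -
  define c where "c = (\<integral>t. 1 / (cmod (Complex a 1 - of_real t))\<^sup>2 \<partial>\<mu>)"
  have c: "c > 0" unfolding c_def by (rule integral_inverse_square_pos[OF \<mu>]) simp
  show ?thesis
  proof (rule that[of "1 / c"])
    fix y :: real assume y: "0 < y" "y \<le> 1"
    let ?G = "cauchy_transform \<mu> (Complex a y)"
    have "c \<le> (\<integral>t. 1 / (cmod (Complex a y - of_real t))\<^sup>2 \<partial>\<mu>)"
      unfolding c_def
    proof (rule integral_mono[OF poisson_integrable[OF \<mu>] poisson_integrable[OF \<mu>]])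
      fix t
      have "y\<^sup>2 \<le> 1" using y by (simp add: power_le_one)
      then show "1 / (cmod (Complex a 1 - of_real t))\<^sup>2 \<le> 1 / (cmod (Complex a y - of_real t))\<^sup>2"
        unfolding cmod_power2 using y by (intro divide_left_mono) (auto intro!: add_nonneg_pos mult_pos_pos)
    qed (use y in auto)
    then have "y * c \<le> - Im ?G"
      using Im_cauchy_transform[OF \<mu>, of "Complex a y"] y by simp
    moreover have "(cmod ?G)\<^sup>2 > 0" using cauchy_transform_nonzero[OF \<mu>, of "Complex a y"] y by simp
    ultimately have "y * c / (cmod ?G)\<^sup>2 \<le> - Im ?G / (cmod ?G)\<^sup>2"
      by (intro divide_right_mono) auto
    moreover have "(cmod (F_transform \<mu> (Complex a y)))\<^sup>2 = 1 / (cmod ?G)\<^sup>2"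
      by (simp add: F_transform_def norm_divide power_divide)
    ultimately have "(y * (cmod (F_transform \<mu> (Complex a y)))\<^sup>2) * c \<le> Im (F_transform \<mu> (Complex a y))"
      unfolding Im_F_transform by simp
    then have "y * (cmod (F_transform \<mu> (Complex a y)))\<^sup>2 \<le> Im (F_transform \<mu> (Complex a y)) / c"
      by (simp only: pos_le_divide_eq[OF c])
    then show "y * (cmod (F_transform \<mu> (Complex a y)))\<^sup>2 \<le> 1 / c * Im (F_transform \<mu> (Complex a y))"
      by simp
  qed (use c in simp)
qed

section \<open>Asymptotics of Cauchy and F-transforms in truncated cones\<close>

lemma cone_norm_le:
  assumes "\<alpha> > 0" "Im z > \<alpha> * \<bar>Re z\<bar>"
  shows "cmod z \<le> (1 + 1 / \<alpha>) * Im z"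
proof -
  have "\<bar>Re z\<bar> \<le> 1 / \<alpha> * Im z" using assms by (simp add: field_simps)
  moreover have "Im z \<ge> 0" using assms by (smt (verit) mult_nonneg_nonneg abs_ge_zero)
  ultimately show ?thesis using cmod_le[of z] by (simp add: algebra_simps)
qed

lemma trunc_cone_Im_pos: "z \<in> trunc_cone \<alpha> M \<Longrightarrow> \<alpha> > 0 \<Longrightarrow> Im z > 0"
  unfolding trunc_cone_def
  by (smt (verit) mem_Collect_eq mult_nonneg_nonneg abs_ge_zero)

text \<open>z G(z) - 1 is the integral of t / (z - t). In the cone this integrand is bounded by
  \<open>K * min 1 (|t| / R)\<close>, which does not depend on \<open>z\<close>, so dominated
  convergence in \<open>R\<close> gives a uniform estimate.\<close>

lemma cauchy_transform_asymp:
  assumes \<mu>: "borel_prob \<mu>" and \<alpha>: "\<alpha> > 0" and e: "\<epsilon> > 0"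
  obtains R where "R > 0" "\<And>z. z \<in> trunc_cone \<alpha> R \<Longrightarrow> cmod (z * cauchy_transform \<mu> z - 1) < \<epsilon>"
proof -
  interpret prob_space \<mu> using \<mu> by (simp add: borel_prob_def)
  \<comment> \<open>In the cone |z| \<le> (1 + 1 / \<alpha>) |z - t|; one further |z - t| comes from
    |t| \<le> |z| + |z - t|.\<close>
  define K where "K = 2 + 1 / \<alpha>"
  have K: "K > 0" using \<alpha> by (simp add: K_def add_pos_pos)
  have mm: "(\<lambda>t. min 1 (\<bar>t\<bar> / R)) \<in> borel_measurable \<mu>" for R :: real
    by (rule borel_prob_measurable[OF \<mu>]) measurable
  have "((\<lambda>R. \<integral>t. min 1 (\<bar>t\<bar> / R) \<partial>\<mu>) \<longlongrightarrow> (\<integral>t. 0 \<partial>\<mu>)) at_top"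
  proof (rule integral_dominated_convergence_at_top[where w = "\<lambda>_. 1"])
    show "AE t in \<mu>. ((\<lambda>R. min 1 (\<bar>t\<bar> / R)) \<longlongrightarrow> 0) at_top"
    proof (rule AE_I2)
      fix t :: real
      have "((\<lambda>R. min 1 (\<bar>t\<bar> / R)) \<longlongrightarrow> min 1 0) at_top"
        by (intro tendsto_intros real_tendsto_divide_at_top[OF tendsto_const] filterlim_ident)
      then show "((\<lambda>R. min 1 (\<bar>t\<bar> / R)) \<longlongrightarrow> 0) at_top" by simp
    qed
    show "\<forall>\<^sub>F R in at_top. AE t in \<mu>. norm (min 1 (\<bar>t\<bar> / R)) \<le> 1"
      using eventually_gt_at_top[of "0::real"] by eventually_elim auto
  qed (use mm in auto)
  then have "((\<lambda>R. \<integral>t. min 1 (\<bar>t\<bar> / R) \<partial>\<mu>) \<longlongrightarrow> 0) at_top" by simp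
  then have "\<forall>\<^sub>F R in at_top. (\<integral>t. min 1 (\<bar>t\<bar> / R) \<partial>\<mu>) < \<epsilon> / K"
    by (rule order_tendstoD) (use e K in simp)
  then have "\<forall>\<^sub>F R in at_top. R > 0 \<and> (\<integral>t. min 1 (\<bar>t\<bar> / R) \<partial>\<mu>) < \<epsilon> / K"
    using eventually_gt_at_top[of "0::real"] by eventually_elim simp
  from eventually_happens'[OF trivial_limit_at_top_linorder this]
  obtain R where R: "R > 0" "(\<integral>t. min 1 (\<bar>t\<bar> / R) \<partial>\<mu>) < \<epsilon> / K" by blast
  show ?thesis
  proof (rule that[OF R(1)])
    fix z assume zc: "z \<in> trunc_cone \<alpha> R"
    then have zR: "cmod z > R" and zI: "Im z > \<alpha> * \<bar>Re z\<bar>" by (auto simp: trunc_cone_def)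
    have z0: "Im z > 0" using trunc_cone_Im_pos[OF zc \<alpha>] .
    have "z * cauchy_transform \<mu> z - 1 = (\<integral>t. z * inverse (z - of_real t) - 1 \<partial>\<mu>)"
      using cauchy_integrable[OF \<mu> z0] by (simp add: cauchy_transform_def prob_space)
    also have "cmod \<dots> \<le> (\<integral>t. K * min 1 (\<bar>t\<bar> / R) \<partial>\<mu>)"
    proof (rule Bochner_Integration.integral_norm_bound_integral)
      show "integrable \<mu> (\<lambda>t. z * inverse (z - complex_of_real t) - 1)"
        using cauchy_integrable[OF \<mu> z0] by simp
      have "integrable \<mu> (\<lambda>t. min 1 (\<bar>t\<bar> / R))"
        by (rule borel_prob_integrable_bounded[OF \<mu>, where B = 1]) (use R in auto)
      then show "integrable \<mu> (\<lambda>t. K * min 1 (\<bar>t\<bar> / R))" by simp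
      fix t
      have d: "cmod (z - of_real t) > 0" using minus_of_real_nonzero[OF z0] by simp
      have "cmod z \<le> (1 + 1 / \<alpha>) * Im z" by (rule cone_norm_le[OF \<alpha> zI])
      also have "\<dots> \<le> (1 + 1 / \<alpha>) * cmod (z - of_real t)"
        by (rule mult_left_mono[OF norm_minus_of_real_ge_Im]) (use \<alpha> in simp)
      finally have 1: "cmod z \<le> (1 + 1 / \<alpha>) * cmod (z - of_real t)" .
      have "\<bar>t\<bar> \<le> cmod z + cmod (z - of_real t)"
        using norm_triangle_ineq4[of z "z - of_real t"] by simp
      with 1 have 2: "\<bar>t\<bar> \<le> K * cmod (z - of_real t)" by (simp add: K_def algebra_simps)
      have "K * cmod (z - of_real t) = (1 + 1 / \<alpha>) * cmod (z - of_real t) + cmod (z - of_real t)"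
        by (simp add: K_def algebra_simps)
      with 1 d have 3: "cmod z \<le> K * cmod (z - of_real t)" by linarith
      have eq: "z * inverse (z - of_real t) - 1 = of_real t / (z - of_real t)"
        using minus_of_real_nonzero[OF z0, of t] by (simp add: field_simps)
      have "\<bar>t\<bar> / cmod (z - of_real t) \<le> K" using 2 d by (simp add: field_simps)
      moreover have "\<bar>t\<bar> / cmod (z - of_real t) \<le> K * (\<bar>t\<bar> / R)"
      proof -
        have "R \<le> K * cmod (z - of_real t)" using 3 zR by linarith
        then have "\<bar>t\<bar> * R \<le> \<bar>t\<bar> * (K * cmod (z - of_real t))" by (rule mult_left_mono) simp
        then show ?thesis using R d by (simp add: field_simps)
      qed
      ultimately show "cmod (z * inverse (z - of_real t) - 1) \<le> K * min 1 (\<bar>t\<bar> / R)"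
        unfolding eq by (auto simp: norm_divide min_def)
    qed
    also have "\<dots> = K * (\<integral>t. min 1 (\<bar>t\<bar> / R) \<partial>\<mu>)" by simp
    also have "\<dots> < \<epsilon>" using R K by (simp add: field_simps)
    finally show "cmod (z * cauchy_transform \<mu> z - 1) < \<epsilon>" .
  qed
qed

lemma F_transform_asymp:
  assumes \<mu>: "borel_prob \<mu>" and \<alpha>: "\<alpha> > 0" and e: "\<epsilon> > 0"
  obtains R where "R > 0" "\<And>z. z \<in> trunc_cone \<alpha> R \<Longrightarrow> cmod (F_transform \<mu> z - z) \<le> \<epsilon> * cmod z"
proof -
  \<comment> \<open>With u = z G(z) one has F(z) - z = z (1 - u) / u. The bound 1/2 keeps |u| \<ge>
    1/2, and \<epsilon> / 2 pays for the resulting factor 2.\<close>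
  define \<delta> where "\<delta> = min (1 / 2) (\<epsilon> / 2)"
  have d: "\<delta> > 0" "\<delta> \<le> 1 / 2" "\<delta> \<le> \<epsilon> / 2" using e by (auto simp: \<delta>_def)
  obtain R where R: "R > 0" "\<And>z. z \<in> trunc_cone \<alpha> R \<Longrightarrow> cmod (z * cauchy_transform \<mu> z - 1) < \<delta>"
    using cauchy_transform_asymp[OF \<mu> \<alpha> d(1)] by blast
  show ?thesis
  proof (rule that[OF R(1)])
    fix z assume z: "z \<in> trunc_cone \<alpha> R"
    let ?u = "z * cauchy_transform \<mu> z"
    have u1: "cmod (?u - 1) < \<delta>" by (rule R(2)[OF z])
    have "1 - cmod ?u \<le> cmod (1 - ?u)" using norm_triangle_ineq2[of 1 ?u] by simp
    then have u: "cmod ?u \<ge> 1 / 2" using u1 d by (simp add: norm_minus_commute)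
    have G: "cauchy_transform \<mu> z \<noteq> 0" using cauchy_transform_nonzero[OF \<mu> trunc_cone_Im_pos[OF z \<alpha>]] .
    have eq: "(F_transform \<mu> z - z) * ?u = z * (1 - ?u)"
      using G by (simp add: F_transform_def field_simps)
    have "cmod (F_transform \<mu> z - z) * (1 / 2) \<le> cmod (F_transform \<mu> z - z) * cmod ?u"
      using u by (intro mult_left_mono) auto
    also have "\<dots> = cmod z * cmod (1 - ?u)" using arg_cong[OF eq, of cmod] by (simp only: norm_mult)
    also have "\<dots> \<le> cmod z * (\<epsilon> / 2)"
      by (rule mult_left_mono) (use u1 d in \<open>auto simp: norm_minus_commute\<close>)
    finally show "cmod (F_transform \<mu> z - z) \<le> \<epsilon> * cmod z" by (simp add: mult.commute)
  qed
qed

section \<open>Stieltjes inversion\<close>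

text \<open>The sign condition covers the real points of the disc, in particular the centre, where
  it becomes positivity of the density.\<close>

definition cauchy_extends_at :: "real measure \<Rightarrow> real \<Rightarrow> bool" where
  "cauchy_extends_at \<rho> x \<longleftrightarrow> (\<exists>r>0. \<exists>g. g holomorphic_on ball (of_real x) r \<and>
     (\<forall>z\<in>ball (of_real x) r. Im (g z) < 0 \<and> (Im z > 0 \<longrightarrow> g z = cauchy_transform \<rho> z)))"

lemma tendsto_Complex_at_right: "((\<lambda>y. Complex x y) \<longlongrightarrow> of_real x) (at_right 0)"
proof -
  have "((\<lambda>y. Complex x y) \<longlongrightarrow> Complex x 0) (at_right 0)"
    by (intro tendsto_Complex tendsto_const tendsto_ident_at)
  then show ?thesis by (simp add: complex_of_real_def)
qed

text \<open>At height 1 / N the Poisson kernel is the \<open>x\<close>-derivative of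
  \<open>arctan ((x - t) * N)\<close>, ready for integration over an interval.\<close>

lemma neg_Im_cauchy_transform_Complex:
  assumes "borel_prob \<rho>" "N > 0"
  shows "- Im (cauchy_transform \<rho> (Complex x (1 / N))) = (\<integral>t. N / (1 + ((x - t) * N)\<^sup>2) \<partial>\<rho>)"
    and "integrable \<rho> (\<lambda>t. N / (1 + ((x - t) * N)\<^sup>2))"
proof -
  have eq: "N / (1 + ((x - t) * N)\<^sup>2) = 1 / N * (1 / (cmod (Complex x (1 / N) - of_real t))\<^sup>2)" for t
  proof -
    have "(cmod (Complex x (1 / N) - of_real t))\<^sup>2 = (x - t)\<^sup>2 + (1 / N)\<^sup>2"
      unfolding cmod_power2 by simp
    also have "\<dots> = (1 + ((x - t) * N)\<^sup>2) / N\<^sup>2"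
      using assms(2) by (simp add: add_divide_distrib power_mult_distrib power_divide add.commute)
    finally show ?thesis using assms(2) by (simp add: power2_eq_square)
  qed
  have pos: "Im (Complex x (1 / N)) > 0" using assms by simp
  show "- Im (cauchy_transform \<rho> (Complex x (1 / N))) = (\<integral>t. N / (1 + ((x - t) * N)\<^sup>2) \<partial>\<rho>)"
    unfolding Im_cauchy_transform[OF assms(1) pos] eq
    by (simp only: integral_mult_right_zero) simp
  show "integrable \<rho> (\<lambda>t. N / (1 + ((x - t) * N)\<^sup>2))"
    unfolding eq by (intro integrable_mult_right poisson_integrable[OF assms(1) pos])
qed

lemma tendsto_arctan_scaled:
  fixes c :: real
  assumes "c \<noteq> 0"
  shows "(\<lambda>n. arctan (c * real (Suc n))) \<longlonglongrightarrow> sgn c * (pi / 2)"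
proof (cases "c > 0")
  case True
  have "filterlim (\<lambda>n. c * real (Suc n)) at_top sequentially"
    by (intro filterlim_tendsto_pos_mult_at_top[OF tendsto_const True]
        filterlim_compose[OF filterlim_real_sequentially filterlim_Suc])
  then show ?thesis
    using filterlim_compose[OF tendsto_arctan_at_top] True by simp
next
  case False
  then have c: "c < 0" using assms by simp
  have "filterlim (\<lambda>n. c * real (Suc n)) at_bot sequentially"
    by (intro filterlim_tendsto_neg_mult_at_bot[OF tendsto_const c]
        filterlim_compose[OF filterlim_real_sequentially filterlim_Suc])
  then show ?thesis
    using filterlim_compose[OF tendsto_arctan_at_bot] c by simp
qed

text \<open>Tonelli exchanges the integrals; the inner one is then computed from the arctan
  primitive of the kernel.\<close>

lemma nn_integral_neg_Im_cauchy_transform: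
  assumes \<rho>: "borel_prob \<rho>" and N: "N > 0" and ab: "a \<le> b"
  shows "(\<integral>\<^sup>+x. ennreal (- Im (cauchy_transform \<rho> (Complex x (1 / N)))) * indicator {a..b} x \<partial>lborel)
    = (\<integral>\<^sup>+t. ennreal (arctan ((b - t) * N) - arctan ((a - t) * N)) \<partial>\<rho>)"
proof -
  interpret prob_space \<rho> using \<rho> by (simp add: borel_prob_def)
  interpret pair_sigma_finite lborel \<rho> ..
  define p where "p x t = N / (1 + ((x - t) * N)\<^sup>2)" for x t :: real
  have p0: "p x t \<ge> 0" for x t using N by (simp add: p_def)
  have sets_pair: "sets (lborel \<Otimes>\<^sub>M \<rho>) = sets (borel \<Otimes>\<^sub>M borel)"
    by (rule sets_pair_measure_cong) (use \<rho> in \<open>auto simp: borel_prob_def\<close>)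
  have "(\<lambda>(x, t). ennreal (p x t) * indicator {a..b} x) \<in> borel_measurable (borel \<Otimes>\<^sub>M borel)"
    unfolding p_def by measurable
  then have meas: "(\<lambda>(x, t). ennreal (p x t) * indicator {a..b} x) \<in> borel_measurable (lborel \<Otimes>\<^sub>M \<rho>)"
    using measurable_cong_sets[OF sets_pair refl] by blast
  have "(\<integral>\<^sup>+x. ennreal (- Im (cauchy_transform \<rho> (Complex x (1 / N)))) * indicator {a..b} x \<partial>lborel)
     = (\<integral>\<^sup>+x. (\<integral>\<^sup>+t. ennreal (p x t) * indicator {a..b} x \<partial>\<rho>) \<partial>lborel)"
  proof (rule nn_integral_cong)
    fix x
    have "ennreal (- Im (cauchy_transform \<rho> (Complex x (1 / N)))) = (\<integral>\<^sup>+t. ennreal (p x t) \<partial>\<rho>)"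
      unfolding neg_Im_cauchy_transform_Complex(1)[OF \<rho> N] p_def
      by (rule nn_integral_eq_integral[symmetric])
         (use neg_Im_cauchy_transform_Complex(2)[OF \<rho> N] N in auto)
    then show "ennreal (- Im (cauchy_transform \<rho> (Complex x (1 / N)))) * indicator {a..b} x
       = (\<integral>\<^sup>+t. ennreal (p x t) * indicator {a..b} x \<partial>\<rho>)"
      by (simp split: split_indicator)
  qed
  also have "\<dots> = (\<integral>\<^sup>+t. (\<integral>\<^sup>+x. ennreal (p x t) * indicator {a..b} x \<partial>lborel) \<partial>\<rho>)"
    by (rule Fubini'[OF meas, symmetric])
  also have "\<dots> = (\<integral>\<^sup>+t. ennreal (arctan ((b - t) * N) - arctan ((a - t) * N)) \<partial>\<rho>)"
  proof (rule nn_integral_cong)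
    fix t
    show "(\<integral>\<^sup>+x. ennreal (p x t) * indicator {a..b} x \<partial>lborel)
      = ennreal (arctan ((b - t) * N) - arctan ((a - t) * N))"
    proof (rule nn_integral_FTC_Icc[OF _ _ p0 ab])
      show "(\<lambda>x. p x t) \<in> borel_measurable borel" unfolding p_def by measurable
      show "((\<lambda>x. arctan ((x - t) * N)) has_real_derivative p x t) (at x)" for x
        unfolding p_def by (auto intro!: derivative_eq_intros simp: divide_simps)
    qed
  qed
  finally show ?thesis .
qed

text \<open>The kernel y^2 / ((x - t)^2 + y^2) dominates the indicator of \<open>{x}\<close>, so the
  atom is at most y * (- Im G), which tends to 0 when G has a finite boundary value.\<close>

lemma cauchy_transform_limit_imp_no_atom:
  assumes \<rho>: "borel_prob \<rho>" and lim: "((\<lambda>y. cauchy_transform \<rho> (Complex x y)) \<longlongrightarrow> L) (at_right 0)"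
  shows "measure \<rho> {x} = 0"
proof -
  interpret prob_space \<rho> using \<rho> by (simp add: borel_prob_def)
  have s: "{x} \<in> sets \<rho>" using \<rho> by (simp add: borel_prob_def)
  have le: "measure \<rho> {x} \<le> y * (- Im (cauchy_transform \<rho> (Complex x y)))" if y: "y > 0" for y
  proof -
    define N where "N = 1 / y"
    have N: "N > 0" "y = 1 / N" using y by (auto simp: N_def)
    have "measure \<rho> {x} = (\<integral>t. indicator {x} t \<partial>\<rho>)" by (simp add: s)
    also have "\<dots> \<le> (\<integral>t. 1 / N * (N / (1 + ((x - t) * N)\<^sup>2)) \<partial>\<rho>)"
    proof (rule integral_mono)
      show "integrable \<rho> (\<lambda>t. 1 / N * (N / (1 + ((x - t) * N)\<^sup>2)))"
        by (intro integrable_mult_right neg_Im_cauchy_transform_Complex(2)[OF \<rho> N(1)])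
      show "integrable \<rho> (indicator {x} :: real \<Rightarrow> real)"
        using s by (simp add: emeasure_eq_measure)
    qed (use N in \<open>auto split: split_indicator\<close>)
    also have "\<dots> = y * (- Im (cauchy_transform \<rho> (Complex x y)))"
      unfolding N(2) neg_Im_cauchy_transform_Complex(1)[OF \<rho> N(1)] by (rule integral_mult_right_zero)
    finally show ?thesis .
  qed
  have "((\<lambda>y. y * (- Im (cauchy_transform \<rho> (Complex x y)))) \<longlongrightarrow> 0 * (- Im L)) (at_right 0)"
    by (intro tendsto_intros lim)
  then have "measure \<rho> {x} \<le> 0 * (- Im L)"
    by (rule tendsto_lowerbound) (use le in \<open>auto simp: eventually_at_right_less eventually_at_filter\<close>)
  then show ?thesis by (simp add: measure_le_0_iff)
qed

text \<open>Both sides are the limit of the integrals of - Im G(x + \<i> / (n + 1)) / pi over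
  \<open>{a..b}\<close>: on the Lebesgue side by continuity of \<open>H\<close> up to the axis, on
  the side of \<open>\<rho>\<close> by the arctan formula.\<close>

lemma emeasure_Icc_stieltjes:
  assumes \<rho>: "borel_prob \<rho>" and Hcont: "continuous_on {z. Im z \<ge> 0} H"
    and HG: "\<And>z. Im z > 0 \<Longrightarrow> H z = cauchy_transform \<rho> z"
    and ab: "a \<le> b"
  defines "f \<equiv> \<lambda>x. - Im (H (complex_of_real x)) / pi"
  shows "emeasure \<rho> {a..b} = emeasure (density lborel (\<lambda>x. ennreal (f x))) {a..b}"
proof -
  interpret prob_space \<rho> using \<rho> by (simp add: borel_prob_def)
  have fcont: "continuous_on UNIV f"
  proof -
    have "continuous_on UNIV (\<lambda>x. H (of_real x))"
      by (rule continuous_on_compose2[OF Hcont]) (auto intro!: continuous_intros)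
    then show ?thesis unfolding f_def by (intro continuous_intros) auto
  qed
  then have fmeas [measurable]: "f \<in> borel_measurable borel"
    by (rule borel_measurable_continuous_onI)
  have glim: "((\<lambda>y. cauchy_transform \<rho> (Complex x y)) \<longlongrightarrow> H (of_real x)) (at_right 0)" for x
  proof -
    have "filterlim (Complex x) (at (complex_of_real x) within {z. Im z \<ge> 0}) (at_right 0)"
      unfolding filterlim_at
      using tendsto_Complex_at_right[of x] eventually_at_right_less[of "0::real"]
      by (auto elim!: eventually_mono simp: complex_eq_iff)
    moreover have "(H \<longlongrightarrow> H (of_real x)) (at (of_real x) within {z. Im z \<ge> 0})"
      using Hcont by (simp add: continuous_on_def)
    ultimately have "((\<lambda>y. H (Complex x y)) \<longlongrightarrow> H (of_real x)) (at_right 0)"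
      by (rule filterlim_compose[rotated])
    moreover have "\<forall>\<^sub>F y in at_right 0. H (Complex x y) = cauchy_transform \<rho> (Complex x y)"
      using eventually_at_right_less[of "0::real"] by eventually_elim (simp add: HG)
    ultimately show ?thesis by (simp cong: tendsto_cong)
  qed
  have f0: "f x \<ge> 0" for x
  proof -
    have "((\<lambda>y. - Im (cauchy_transform \<rho> (Complex x y)) / pi) \<longlongrightarrow> f x) (at_right 0)"
      unfolding f_def by (intro tendsto_intros glim) auto
    moreover have "\<forall>\<^sub>F y in at_right 0. 0 \<le> - Im (cauchy_transform \<rho> (Complex x y)) / pi"
      using eventually_at_right_less[of "0::real"]
    proof eventually_elim
      case (elim y)
      then have "Im (cauchy_transform \<rho> (Complex x y)) < 0" by (intro Im_cauchy_transform_neg[OF \<rho>]) simp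
      then show ?case by (intro divide_nonneg_pos) auto
    qed
    ultimately show ?thesis by (rule tendsto_lowerbound) simp
  qed
  \<comment> \<open>At an endpoint the limit of the arctan differences is not the value of the
    indicator, so endpoints must carry no mass.\<close>
  have atoms: "AE t in \<rho>. t \<noteq> x" for x
  proof (rule AE_I)
    have "measure \<rho> {x} = 0"
      by (rule cauchy_transform_limit_imp_no_atom[OF \<rho> glim])
    then show "emeasure \<rho> {x} = 0" by (simp add: emeasure_eq_measure)
  qed (use \<rho> in \<open>auto simp: borel_prob_def\<close>)
  define A where "A n t = (arctan ((b - t) * real (Suc n)) - arctan ((a - t) * real (Suc n))) / pi" for n t
  define u where "u n x = - Im (cauchy_transform \<rho> (Complex x (1 / real (Suc n)))) / pi" for n x
  have u0: "u n x \<ge> 0" for n x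
    unfolding u_def using Im_cauchy_transform_neg[OF \<rho>, of "Complex x (1 / real (Suc n))"]
    by (intro divide_nonneg_pos) auto
  have A0: "A n t \<ge> 0" for n t
    unfolding A_def using ab by (simp add: arctan_monotone' mult_right_mono)
  have A1: "A n t \<le> 1" for n t
    unfolding A_def using arctan_bounded[of "(b - t) * real (Suc n)"] arctan_bounded[of "(a - t) * real (Suc n)"]
    by (simp add: field_simps)
  have Am: "A n \<in> borel_measurable borel" for n unfolding A_def by measurable
  have Ai: "integrable \<rho> (A n)" for n
    by (rule borel_prob_integrable_bounded[OF \<rho> Am, where B = 1]) (use A0 A1 in auto)
  \<comment> \<open>All sampling heights 1 / (n + 1) lie in (0, 1], so one compact rectangle yields
    the dominating constant \<open>B / pi\<close>.\<close>
  have "compact (cbox (Complex a 0) (Complex b 1))" by (rule compact_cbox)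
  moreover have "continuous_on (cbox (Complex a 0) (Complex b 1)) H"
    by (rule continuous_on_subset[OF Hcont]) (auto simp: in_cbox_complex_iff)
  ultimately have "bounded (H ` cbox (Complex a 0) (Complex b 1))"
    by (intro compact_imp_bounded compact_continuous_image)
  then obtain B where B: "\<And>z. z \<in> cbox (Complex a 0) (Complex b 1) \<Longrightarrow> cmod (H z) \<le> B"
    unfolding bounded_iff by auto
  have uH: "u n x = - Im (H (Complex x (1 / real (Suc n)))) / pi" for n x
    by (simp add: u_def HG)
  have uB: "norm (u n x * indicator {a..b} x) \<le> B / pi * indicator {a..b} x" for n x
  proof (cases "x \<in> {a..b}")
    case True
    then have "cmod (H (Complex x (1 / real (Suc n)))) \<le> B"
      by (intro B) (auto simp: in_cbox_complex_iff)
    then have "\<bar>Im (H (Complex x (1 / real (Suc n))))\<bar> \<le> B"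
      using abs_Im_le_cmod order_trans by blast
    then show ?thesis using True unfolding uH by (simp add: divide_right_mono)
  qed simp
  have ucont: "continuous_on UNIV (u n)" for n
  proof -
    have "continuous_on UNIV (\<lambda>x. H (Complex x (1 / real (Suc n))))"
      by (rule continuous_on_compose2[OF Hcont]) (auto intro!: continuous_intros simp: Complex_eq)
    then show ?thesis unfolding uH by (intro continuous_intros) auto
  qed
  then have um [measurable]: "u n \<in> borel_measurable borel" for n
    by (intro borel_measurable_continuous_onI)
  have int_ind: "integrable lborel (\<lambda>x. C * indicator {a..b} x)" for C :: real
    by (intro integrable_mult_right) (simp add: integrable_indicator_iff emeasure_lborel_Icc_eq)
  have ui: "integrable lborel (\<lambda>x. u n x * indicator {a..b} x)" for n
  proof (rule Bochner_Integration.integrable_bound[OF int_ind[of "B / pi"]])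
    show "AE x in lborel. norm (u n x * indicator {a..b} x) \<le> norm (B / pi * indicator {a..b} x)"
      by (intro AE_I2 order_trans[OF uB]) (simp only: real_norm_def abs_ge_self)
  qed measurable
  have eq: "(\<integral>x. u n x * indicator {a..b} x \<partial>lborel) = (\<integral>t. A n t \<partial>\<rho>)" for n
  proof -
    have "ennreal (\<integral>x. u n x * indicator {a..b} x \<partial>lborel) = (\<integral>\<^sup>+x. ennreal (u n x * indicator {a..b} x) \<partial>lborel)"
      by (rule nn_integral_eq_integral[symmetric, OF ui]) (use u0 in auto)
    also have "\<dots> = (\<integral>\<^sup>+x. ennreal (1 / pi) * (ennreal (- Im (cauchy_transform \<rho> (Complex x (1 / real (Suc n))))) * indicator {a..b} x) \<partial>lborel)"
      by (rule nn_integral_cong) (auto simp: u_def ennreal_mult'[symmetric] split: split_indicator)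
    also have "\<dots> = ennreal (1 / pi) * (\<integral>\<^sup>+x. ennreal (- Im (cauchy_transform \<rho> (Complex x (1 / real (Suc n))))) * indicator {a..b} x \<partial>lborel)"
    proof (rule nn_integral_cmult)
      have "(\<lambda>x. ennreal (pi * u n x) * indicator {a..b} x) \<in> borel_measurable lborel" by measurable
      then show "(\<lambda>x. ennreal (- Im (cauchy_transform \<rho> (Complex x (1 / real (Suc n))))) * indicator {a..b} x) \<in> borel_measurable lborel"
        by (simp add: u_def)
    qed
    also have "\<dots> = ennreal (1 / pi) * (\<integral>\<^sup>+t. ennreal (arctan ((b - t) * real (Suc n)) - arctan ((a - t) * real (Suc n))) \<partial>\<rho>)"
      by (subst nn_integral_neg_Im_cauchy_transform[OF \<rho> _ ab]) auto
    also have "\<dots> = (\<integral>\<^sup>+t. ennreal (1 / pi) * ennreal (arctan ((b - t) * real (Suc n)) - arctan ((a - t) * real (Suc n))) \<partial>\<rho>)"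
      by (rule nn_integral_cmult[symmetric], rule borel_prob_measurable[OF \<rho>]) measurable
    also have "\<dots> = (\<integral>\<^sup>+t. ennreal (A n t) \<partial>\<rho>)"
      by (rule nn_integral_cong) (simp add: A_def ennreal_mult'[symmetric])
    also have "\<dots> = ennreal (\<integral>t. A n t \<partial>\<rho>)"
      by (rule nn_integral_eq_integral[OF Ai]) (use A0 in auto)
    finally show ?thesis using u0 A0 by simp
  qed
  have lim1: "(\<lambda>n. \<integral>x. u n x * indicator {a..b} x \<partial>lborel) \<longlonglongrightarrow> (\<integral>x. f x * indicator {a..b} x \<partial>lborel)"
  proof (rule integral_dominated_convergence[OF _ _ int_ind[of "B / pi"]])
    have "(\<lambda>n. u n x) \<longlonglongrightarrow> f x" for x
    proof -
      have "filterlim (\<lambda>n. 1 / real (Suc n)) (at_right 0) sequentially"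
        unfolding filterlim_at using LIMSEQ_inverse_real_of_nat by (simp add: inverse_eq_divide)
      then have "(\<lambda>n. cauchy_transform \<rho> (Complex x (1 / real (Suc n)))) \<longlonglongrightarrow> H (of_real x)"
        by (rule filterlim_compose[OF glim])
      then show ?thesis unfolding u_def f_def by (intro tendsto_intros) auto
    qed
    then show "AE x in lborel. (\<lambda>n. u n x * indicator {a..b} x) \<longlonglongrightarrow> f x * indicator {a..b} x"
      by (intro AE_I2 tendsto_intros)
  qed (use uB in auto)
  have lim2: "(\<lambda>n. \<integral>t. A n t \<partial>\<rho>) \<longlonglongrightarrow> (\<integral>t. indicator {a..b} t \<partial>\<rho>)"
  proof (rule integral_dominated_convergence[where w = "\<lambda>_. 1"])
    show "AE t in \<rho>. (\<lambda>n. A n t) \<longlonglongrightarrow> indicator {a..b} t"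
      using atoms[of a] atoms[of b]
    proof eventually_elim
      case (elim t)
      have "(\<lambda>n. A n t) \<longlonglongrightarrow> (sgn (b - t) * (pi / 2) - sgn (a - t) * (pi / 2)) / pi"
        unfolding A_def by (intro tendsto_intros tendsto_arctan_scaled) (use elim in auto)
      moreover have "(sgn (b - t) * (pi / 2) - sgn (a - t) * (pi / 2)) / pi = indicator {a..b} t"
        using elim ab by (auto simp: sgn_if split: split_indicator)
      ultimately show ?case by simp
    qed
    show "indicator {a..b} \<in> borel_measurable \<rho>" by (rule borel_prob_measurable[OF \<rho>]) measurable
    show "A n \<in> borel_measurable \<rho>" for n by (rule borel_prob_measurable[OF \<rho> Am])
  qed (use A0 A1 in auto)
  have "(\<integral>x. f x * indicator {a..b} x \<partial>lborel) = (\<integral>t. indicator {a..b} t \<partial>\<rho>)"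
    using LIMSEQ_unique[OF lim1] lim2 by (simp add: eq)
  also have "\<dots> = measure \<rho> {a..b}" using \<rho> by (simp add: borel_prob_def)
  finally have m: "measure \<rho> {a..b} = (\<integral>x. f x * indicator {a..b} x \<partial>lborel)" ..
  have fi: "integrable lborel (\<lambda>x. f x * indicator {a..b} x)"
    using borel_integrable_atLeastAtMost'[of a b f] continuous_on_subset[OF fcont]
    by (simp add: set_integrable_def mult.commute)
  have "emeasure \<rho> {a..b} = ennreal (\<integral>x. f x * indicator {a..b} x \<partial>lborel)"
    by (simp add: emeasure_eq_measure m)
  also have "\<dots> = (\<integral>\<^sup>+x. ennreal (f x * indicator {a..b} x) \<partial>lborel)"
    by (rule nn_integral_eq_integral[symmetric, OF fi]) (use f0 in auto)
  also have "\<dots> = (\<integral>\<^sup>+x. ennreal (f x) * indicator {a..b} x \<partial>lborel)"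
    by (rule nn_integral_cong) (auto split: split_indicator)
  also have "\<dots> = emeasure (density lborel (\<lambda>x. ennreal (f x))) {a..b}"
    by (subst emeasure_density) auto
  finally show ?thesis .
qed

theorem stieltjes_inversion_continuous:
  assumes \<rho>: "borel_prob \<rho>" and Hcont: "continuous_on {z. Im z \<ge> 0} H"
    and HG: "\<And>z. Im z > 0 \<Longrightarrow> H z = cauchy_transform \<rho> z"
  defines "f \<equiv> \<lambda>x. - Im (H (complex_of_real x)) / pi"
  shows "\<rho> = density lborel (\<lambda>x. ennreal (f x))"
proof -
  interpret prob_space \<rho> using \<rho> by (simp add: borel_prob_def)
  have interval: "emeasure \<rho> {a..b} = emeasure (density lborel (\<lambda>x. ennreal (f x))) {a..b}" for a b
    using emeasure_Icc_stieltjes[OF \<rho> Hcont HG, of a b] unfolding f_def by (cases "a \<le> b") auto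
  let ?E = "range (\<lambda>(a, b). {a..b::real})"
  have sb: "sets borel = sigma_sets UNIV ?E"
    by (subst borel_eq_atLeastAtMost) simp
  show ?thesis
  proof (rule measure_eqI_generator_eq[where E = ?E and \<Omega> = UNIV and A = "\<lambda>i. {- real i..real i}"])
    show "Int_stable ?E" by (auto simp: Int_stable_def)
    show "emeasure \<rho> X = emeasure (density lborel (\<lambda>x. ennreal (f x))) X" if "X \<in> ?E" for X
      using that interval by auto
    show "sets \<rho> = sigma_sets UNIV ?E" using \<rho> sb by (simp add: borel_prob_def)
    show "sets (density lborel (\<lambda>x. ennreal (f x))) = sigma_sets UNIV ?E" using sb by simp
    show "(\<Union>i. {- real i..real i}) = UNIV"
    proof -
      have "\<exists>i::nat. - real i \<le> x \<and> x \<le> real i" for x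
        using real_arch_simple[of "\<bar>x\<bar>"] by (auto simp: abs_le_iff) (metis minus_le_iff)
      then show ?thesis by auto
    qed
  qed auto
qed

text \<open>Local extensions agree at common real points, where each is the vertical limit of the
  same Cauchy transform. This glues them into one boundary function, whose local power series give
  analyticity.\<close>

theorem stieltjes_inversion:
  assumes \<rho>: "borel_prob \<rho>" and ext: "\<And>x. cauchy_extends_at \<rho> x"
  obtains f where "\<And>x. f x > 0" "real_analytic_on f UNIV" "\<rho> = density lborel (\<lambda>x. ennreal (f x))"
proof -
  interpret prob_space \<rho> using \<rho> by (simp add: borel_prob_def)
  have "\<forall>x. \<exists>r g. r > 0 \<and> g holomorphic_on ball (of_real x) r \<and>
     (\<forall>z\<in>ball (of_real x) r. Im (g z) < 0 \<and> (Im z > 0 \<longrightarrow> g z = cauchy_transform \<rho> z))"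
    using ext unfolding cauchy_extends_at_def by blast
  then obtain r :: "real \<Rightarrow> real" and g where r: "\<And>x. r x > 0"
    and gh: "\<And>x. g x holomorphic_on ball (of_real x) (r x)"
    and gneg: "\<And>x z. z \<in> ball (of_real x) (r x) \<Longrightarrow> Im (g x z) < 0"
    and geq: "\<And>x z. z \<in> ball (of_real x) (r x) \<Longrightarrow> Im z > 0 \<Longrightarrow> g x z = cauchy_transform \<rho> z"
    by metis
  have glim: "((\<lambda>y. cauchy_transform \<rho> (Complex x y)) \<longlongrightarrow> g x0 (of_real x)) (at_right 0)"
    if x: "of_real x \<in> ball (complex_of_real x0) (r x0)" for x x0
  proof -
    have "isCont (g x0) (of_real x)"
      using gh[of x0] x by (meson continuous_on_eq_continuous_at holomorphic_on_imp_continuous_on open_ball)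
    then have 1: "((\<lambda>y. g x0 (Complex x y)) \<longlongrightarrow> g x0 (of_real x)) (at_right 0)"
      by (rule isCont_tendsto_compose[OF _ tendsto_Complex_at_right])
    have "\<forall>\<^sub>F y in at_right 0. Complex x y \<in> ball (of_real x0) (r x0)"
      by (rule topological_tendstoD[OF tendsto_Complex_at_right open_ball x])
    then have "\<forall>\<^sub>F y in at_right 0. g x0 (Complex x y) = cauchy_transform \<rho> (Complex x y)"
      using eventually_at_right_less[of "0::real"] by eventually_elim (use geq in auto)
    from tendsto_cong[OF this] 1 show ?thesis by simp
  qed
  define h where "h x = g x (of_real x)" for x
  have hg: "h x = g x0 (of_real x)" if "of_real x \<in> ball (complex_of_real x0) (r x0)" for x x0
    using tendsto_unique[OF _ glim[OF that] glim[of x x]] r unfolding h_def by simp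
  define f where "f x = - Im (h x) / pi" for x
  have fpos: "f x > 0" for x
    using gneg[of "of_real x" x] r by (simp add: f_def h_def divide_neg_pos)
  have analytic: "real_analytic_on f UNIV"
    unfolding real_analytic_on_def
  proof (intro ballI)
    fix x :: real
    define c where "c n = (deriv ^^ n) (g x) (of_real x) / fact n" for n
    show "\<exists>r>0. \<exists>a. \<forall>y. \<bar>y - x\<bar> < r \<longrightarrow> (\<lambda>n. a n * (y - x) ^ n) sums f y"
    \<comment> \<open>Powers of the real number \<open>y - x\<close> are real, so imaginary parts
      can be taken coefficient by coefficient.\<close>
    proof (intro exI[of _ "r x"] conjI r exI[of _ "\<lambda>n. - Im (c n) / pi"] allI impI)
      fix y assume y: "\<bar>y - x\<bar> < r x"
      then have yb: "of_real y \<in> ball (complex_of_real x) (r x)"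
        by (simp add: dist_of_real dist_real_def abs_minus_commute)
      have "(\<lambda>n. c n * (of_real y - of_real x) ^ n) sums g x (of_real y)"
        unfolding c_def by (rule holomorphic_power_series[OF gh yb])
      then have "(\<lambda>n. Im (c n * (of_real y - of_real x) ^ n)) sums Im (g x (of_real y))"
        by (rule sums_Im)
      moreover have "Im (c n * (of_real y - of_real x) ^ n) = Im (c n) * (y - x) ^ n" for n
        by (simp flip: of_real_diff of_real_power)
      ultimately have "(\<lambda>n. Im (c n) * (y - x) ^ n) sums Im (h y)"
        by (simp add: hg[OF yb])
      from sums_mult[OF this, of "- 1 / pi"]
      show "(\<lambda>n. - Im (c n) / pi * (y - x) ^ n) sums f y" by (simp add: f_def)
    qed
  qed
  define H where "H z = (if Im z > 0 then cauchy_transform \<rho> z else h (Re z))" for z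
  have Hg: "H z = g x z" if "z \<in> ball (of_real x) (r x)" "Im z \<ge> 0" for x z
  proof (cases "Im z > 0")
    case False
    then have "z = of_real (Re z)" using that by (simp add: complex_eq_iff)
    then show ?thesis using hg[of "Re z" x] that False by (metis H_def)
  qed (use geq that in \<open>simp add: H_def\<close>)
  have Hcont: "continuous_on {z. Im z \<ge> 0} H"
    unfolding continuous_on_eq_continuous_within
  proof
    fix z assume "z \<in> {z. Im z \<ge> 0}"
    then consider "Im z > 0" | "Im z = 0" by fastforce
    then show "continuous (at z within {z. Im z \<ge> 0}) H"
    proof cases
      case 1
      have "isCont (cauchy_transform \<rho>) z"
        using cauchy_transform_holomorphic[OF \<rho>] open_upper_half 1
        by (meson continuous_on_eq_continuous_at holomorphic_on_imp_continuous_on mem_upper_half)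
      moreover have "\<forall>\<^sub>F w in nhds z. cauchy_transform \<rho> w = H w"
        using eventually_nhds_in_open[OF open_upper_half, of z] 1
        by (auto elim!: eventually_mono simp: H_def)
      ultimately have "isCont H z" using isCont_cong by blast
      then show ?thesis by (rule continuous_at_imp_continuous_at_within)
    next
      case 2
      define x where "x = Re z"
      have zx: "z = of_real x" using 2 by (simp add: x_def complex_eq_iff)
      have "isCont (g x) z"
        using gh[of x] r[of x] zx by (meson centre_in_ball continuous_on_eq_continuous_at holomorphic_on_imp_continuous_on open_ball)
      then have "continuous (at z within {z. Im z \<ge> 0}) (g x)" by (rule continuous_at_imp_continuous_at_within)
      then show ?thesis
        by (rule continuous_transform_within[OF _ r[of x]])
           (use 2 zx Hg in \<open>auto simp: dist_commute\<close>)
    qed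
  qed
  have "\<rho> = density lborel (\<lambda>x. ennreal (f x))"
    using stieltjes_inversion_continuous[OF \<rho> Hcont] by (simp add: H_def f_def)
  with fpos analytic show ?thesis using that by blast
qed

section \<open>Nontangential limits from Julia's inequality\<close>

lemma norm_le_of_nt_cone:
  assumes "z \<in> nt_cone b c"
  shows "cmod (z - of_real b) \<le> (1 + c) * Im z"
  using assms cmod_le[of "z - of_real b"] by (simp add: nt_cone_def algebra_simps)

text \<open>Julia's lemma with boundary quotient at most 1: Schwarz-Pick passes to the limit as |f z
  - s|^2 * Im z \<le> |z - b|^2 * Im (f z). As \<open>s\<close> is real, Im (f z) \<le> |f z - s|,
  which cancels one factor; in a cone |z - b| is comparable to Im z, so f z - s = O(|z -
  b|).\<close>

lemma nt_lim_at_of_julia: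
  assumes hol: "f holomorphic_on upper_half" and im: "\<And>z. Im z > 0 \<Longrightarrow> Im (f z) > 0"
    and \<zeta>: "\<And>n. Im (\<zeta> n) > 0" and lim: "\<zeta> \<longlonglongrightarrow> of_real b"
    and flim: "(\<lambda>n. f (\<zeta> n)) \<longlonglongrightarrow> of_real s"
    and le: "\<And>n. Im (f (\<zeta> n)) \<le> Im (\<zeta> n)"
  shows "nt_lim_at f b (of_real s)"
proof -
  have julia: "cmod (f z - of_real s) * Im z \<le> (cmod (z - of_real b))\<^sup>2" if z: "Im z > 0" for z
  proof -
    have "(cmod (f z - f (\<zeta> n)))\<^sup>2 * Im z \<le> (cmod (z - \<zeta> n))\<^sup>2 * Im (f z)" for n
    proof -
      have "(cmod (f z - f (\<zeta> n)))\<^sup>2 * (Im z * Im (\<zeta> n)) \<le> (cmod (z - \<zeta> n))\<^sup>2 * (Im (f z) * Im (f (\<zeta> n)))"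
        by (rule schwarz_pick_upper_half[OF hol im z \<zeta>])
      also have "\<dots> \<le> (cmod (z - \<zeta> n))\<^sup>2 * (Im (f z) * Im (\<zeta> n))"
        using le[of n] im[OF z] by (intro mult_left_mono) auto
      finally have "((cmod (f z - f (\<zeta> n)))\<^sup>2 * Im z) * Im (\<zeta> n) \<le> ((cmod (z - \<zeta> n))\<^sup>2 * Im (f z)) * Im (\<zeta> n)"
        by (simp only: mult.assoc)
      then show ?thesis using \<zeta>[of n] by (simp only: mult_le_cancel_right_pos)
    qed
    then have "(cmod (f z - of_real s))\<^sup>2 * Im z \<le> (cmod (z - of_real b))\<^sup>2 * Im (f z)"
      by (intro LIMSEQ_le[of "\<lambda>n. (cmod (f z - f (\<zeta> n)))\<^sup>2 * Im z" _ "\<lambda>n. (cmod (z - \<zeta> n))\<^sup>2 * Im (f z)"]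
          tendsto_intros lim flim) auto
    also have "\<dots> \<le> (cmod (z - of_real b))\<^sup>2 * cmod (f z - of_real s)"
      using abs_Im_le_cmod[of "f z - of_real s"] by (intro mult_left_mono) auto
    finally have "cmod (f z - of_real s) * (cmod (f z - of_real s) * Im z) \<le> cmod (f z - of_real s) * (cmod (z - of_real b))\<^sup>2"
      by (simp add: power2_eq_square mult_ac)
    moreover have "cmod (f z - of_real s) > 0" using im[OF z] by (auto simp: complex_eq_iff)
    ultimately show ?thesis by (simp only: mult_le_cancel_left_pos)
  qed
  show ?thesis
    unfolding nt_lim_at_def
  proof (intro allI impI)
    fix c :: real assume c: "c > 0"
    have "\<forall>\<^sub>F z in at (of_real b) within nt_cone b c. cmod (f z - of_real s) \<le> (1 + c) * cmod (z - of_real b)"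
      unfolding eventually_at_filter
    proof (intro always_eventually allI impI)
      fix z assume zc: "z \<in> nt_cone b c"
      then have z: "Im z > 0" by (simp add: nt_cone_def)
      have "cmod (f z - of_real s) * Im z \<le> cmod (z - of_real b) * cmod (z - of_real b)"
        using julia[OF z] by (simp add: power2_eq_square)
      also have "\<dots> \<le> cmod (z - of_real b) * ((1 + c) * Im z)"
        by (intro mult_left_mono norm_le_of_nt_cone zc) auto
      finally have "cmod (f z - of_real s) * Im z \<le> ((1 + c) * cmod (z - of_real b)) * Im z"
        by (simp only: mult_ac)
      then show "cmod (f z - of_real s) \<le> (1 + c) * cmod (z - of_real b)"
        using z by (simp only: mult_le_cancel_right_pos)
    qed
    moreover
    have "((\<lambda>z. (1 + c) * cmod (z - of_real b)) \<longlongrightarrow> (1 + c) * cmod (of_real b - of_real b)) (at (of_real b) within nt_cone b c)"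
      by (intro tendsto_intros)
    then have "((\<lambda>z. (1 + c) * cmod (z - of_real b)) \<longlongrightarrow> 0) (at (of_real b) within nt_cone b c)"
      by simp
    ultimately have "((\<lambda>z. f z - of_real s) \<longlongrightarrow> 0) (at (of_real b) within nt_cone b c)"
      by (rule Lim_null_comparison)
    then show "(f \<longlongrightarrow> of_real s) (at (of_real b) within nt_cone b c)"
      by (rule Lim_null[THEN iffD2])
  qed
qed

text \<open>Julia's lemma at infinity: Im \<zeta> / |\<zeta>|^2 is the height of -1 / \<zeta>, so
  \<open>le\<close> bounds the boundary quotient in that coordinate. The limit inequality yields |f
  z - s| * Im z \<le> C.\<close>

lemma nt_lim_inf_of_julia:
  assumes hol: "f holomorphic_on upper_half" and im: "\<And>z. Im z > 0 \<Longrightarrow> Im (f z) > 0"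
    and \<zeta>: "\<And>n. Im (\<zeta> n) > 0" and lim: "filterlim \<zeta> at_infinity sequentially"
    and flim: "(\<lambda>n. f (\<zeta> n)) \<longlonglongrightarrow> of_real s"
    and le: "\<And>n. Im (f (\<zeta> n)) * (cmod (\<zeta> n))\<^sup>2 \<le> C * Im (\<zeta> n)"
  shows "nt_lim_inf f (of_real s)"
proof -
  have julia: "cmod (f z - of_real s) * Im z \<le> C" if z: "Im z > 0" for z
  proof -
    have "(cmod (f z - f (\<zeta> n)))\<^sup>2 * Im z \<le> (cmod (z / \<zeta> n - 1))\<^sup>2 * (C * Im (f z))" for n
    proof -
      have n0: "\<zeta> n \<noteq> 0" using \<zeta>[of n] by auto
      \<comment> \<open>Pulling \<zeta> out moves the divergent factor |\<zeta>|^2 next to Im (f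
        \<zeta>), where \<open>le\<close> absorbs it; the rest z / \<zeta> - 1 tends to -1.\<close>
      have "z - \<zeta> n = (z / \<zeta> n - 1) * \<zeta> n" using n0 by (simp add: field_simps)
      then have e: "(cmod (z - \<zeta> n))\<^sup>2 = (cmod (z / \<zeta> n - 1))\<^sup>2 * (cmod (\<zeta> n))\<^sup>2"
        by (metis norm_mult power_mult_distrib)
      have "(cmod (f z - f (\<zeta> n)))\<^sup>2 * (Im z * Im (\<zeta> n)) \<le> (cmod (z - \<zeta> n))\<^sup>2 * (Im (f z) * Im (f (\<zeta> n)))"
        by (rule schwarz_pick_upper_half[OF hol im z \<zeta>])
      also have "\<dots> = ((cmod (z / \<zeta> n - 1))\<^sup>2 * Im (f z)) * (Im (f (\<zeta> n)) * (cmod (\<zeta> n))\<^sup>2)"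
        unfolding e by (simp only: mult_ac)
      also have "\<dots> \<le> ((cmod (z / \<zeta> n - 1))\<^sup>2 * Im (f z)) * (C * Im (\<zeta> n))"
        using im[OF z] by (intro mult_left_mono le) auto
      finally have "((cmod (f z - f (\<zeta> n)))\<^sup>2 * Im z) * Im (\<zeta> n) \<le> ((cmod (z / \<zeta> n - 1))\<^sup>2 * (C * Im (f z))) * Im (\<zeta> n)"
        by (simp only: mult_ac)
      then show ?thesis using \<zeta>[of n] by (simp only: mult_le_cancel_right_pos)
    qed
    moreover have "(\<lambda>n. z / \<zeta> n) \<longlonglongrightarrow> 0"
      by (rule tendsto_divide_0[OF tendsto_const lim])
    ultimately have "(cmod (f z - of_real s))\<^sup>2 * Im z \<le> (cmod (0 - 1))\<^sup>2 * (C * Im (f z))"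
      by (intro LIMSEQ_le[of "\<lambda>n. (cmod (f z - f (\<zeta> n)))\<^sup>2 * Im z" _ "\<lambda>n. (cmod (z / \<zeta> n - 1))\<^sup>2 * (C * Im (f z))"]
          tendsto_intros flim) auto
    also have "\<dots> = C * Im (f z)" by simp
    also have "\<dots> \<le> C * cmod (f z - of_real s)"
    proof (rule mult_left_mono)
      \<comment> \<open>The sign of \<open>C\<close> is read off from \<open>le\<close> at index
        0.\<close>
      have "0 \<le> C * Im (\<zeta> 0)" using order_trans[OF _ le[of 0]] im[OF \<zeta>[of 0]] by simp
      then show "C \<ge> 0" using \<zeta>[of 0] by (simp add: zero_le_mult_iff)
    qed (use abs_Im_le_cmod[of "f z - of_real s"] in auto)
    finally have "cmod (f z - of_real s) * (cmod (f z - of_real s) * Im z) \<le> cmod (f z - of_real s) * C"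
      by (simp add: power2_eq_square mult_ac)
    moreover have "cmod (f z - of_real s) > 0" using im[OF z] by (auto simp: complex_eq_iff)
    ultimately show ?thesis by (simp only: mult_le_cancel_left_pos)
  qed
  show ?thesis
    unfolding nt_lim_inf_def
  proof (intro allI impI)
    fix c :: real assume c: "c > 0"
    let ?F = "at_infinity \<sqinter> principal (nt_cone_inf c)"
    have "\<forall>\<^sub>F z in ?F. cmod (f z - of_real s) \<le> (1 + c) * C / cmod z"
      unfolding eventually_inf_principal
    proof (intro always_eventually allI impI)
      fix z assume zc: "z \<in> nt_cone_inf c"
      then have z: "Im z > 0" by (simp add: nt_cone_inf_def)
      have "cmod (f z - of_real s) * cmod z \<le> cmod (f z - of_real s) * ((1 + c) * Im z)"
        using zc norm_le_of_nt_cone[of z 0 c] by (intro mult_left_mono) (auto simp: nt_cone_inf_def nt_cone_def)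
      also have "\<dots> = (1 + c) * (cmod (f z - of_real s) * Im z)" by (simp only: mult_ac)
      also have "\<dots> \<le> (1 + c) * C" using c by (intro mult_left_mono julia z) auto
      finally have "cmod (f z - of_real s) * cmod z \<le> (1 + c) * C" .
      moreover have "cmod z > 0" using z by auto
      ultimately show "cmod (f z - of_real s) \<le> (1 + c) * C / cmod z"
        by (simp only: pos_le_divide_eq)
    qed
    moreover have "((\<lambda>z. (1 + c) * C / cmod z) \<longlongrightarrow> 0) ?F"
    proof (rule tendsto_divide_0[OF tendsto_const])
      have "filterlim (cmod :: complex \<Rightarrow> real) at_top at_infinity" by (rule filterlim_norm_at_top)
      then have "filterlim (cmod :: complex \<Rightarrow> real) at_top ?F" by (rule filterlim_mono) auto
      then show "filterlim (cmod :: complex \<Rightarrow> real) at_infinity ?F" by (rule filterlim_at_top_imp_at_infinity)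
    qed
    ultimately have "((\<lambda>z. f z - of_real s) \<longlongrightarrow> 0) ?F"
      by (rule Lim_null_comparison)
    then show "(f \<longlongrightarrow> of_real s) ?F" by (rule Lim_null[THEN iffD2])
  qed
qed

section \<open>Excluding real nontangential limits and boundary fixed points\<close>

lemma nt_lim_at_vertical:
  assumes "nt_lim_at f b L"
  shows "((\<lambda>y. f (Complex b y)) \<longlongrightarrow> L) (at_right 0)"
proof -
  have 1: "(f \<longlongrightarrow> L) (at (of_real b) within nt_cone b 1)"
    using assms by (simp add: nt_lim_at_def)
  have 2: "filterlim (Complex b) (at (complex_of_real b) within nt_cone b 1) (at_right 0)"
    unfolding filterlim_at
    using tendsto_Complex_at_right[of b] eventually_at_right_less[of "0::real"]
    by (auto elim!: eventually_mono simp: complex_eq_iff nt_cone_def)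
  show ?thesis by (rule filterlim_compose[OF 1 2])
qed

lemma nt_lim_at_unique: "nt_lim_at f b L \<Longrightarrow> nt_lim_at f b L' \<Longrightarrow> L = L'"
  using tendsto_unique[OF _ nt_lim_at_vertical[of f b L] nt_lim_at_vertical[of f b L']] by simp

lemma filterlim_vertical_at_infinity:
  "filterlim (Complex 0) (at_infinity \<sqinter> principal (nt_cone_inf 1)) at_top"
proof -
  have "filterlim (Complex 0) at_infinity at_top"
    unfolding filterlim_at_infinity[OF order_refl]
  proof (intro allI impI)
    fix r :: real
    show "\<forall>\<^sub>F y in at_top. r \<le> cmod (Complex 0 y)"
      by (rule eventually_mono[OF eventually_ge_at_top[of r]]) (simp add: cmod_def)
  qed
  moreover have "\<forall>\<^sub>F y in at_top. Complex 0 y \<in> nt_cone_inf 1"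
    by (rule eventually_mono[OF eventually_gt_at_top[of 0]]) (simp add: nt_cone_inf_def)
  ultimately show ?thesis by (simp add: filterlim_inf filterlim_principal)
qed

text \<open>Limits are compared along the imaginary axis. Sequences in any cone can produce no value
  but \<open>L\<close>, so neither a second point nor infinity enters the cluster set.\<close>

lemma nt_lim_inf_excludes:
  assumes lim: "nt_lim_inf f L"
  shows "\<not> nt_lim_inf_infty f" "nt_lim_inf f L' \<Longrightarrow> L' = L" "\<not> nt_cluster_more_than_one f"
proof -
  have v: "((\<lambda>y. f (Complex 0 y)) \<longlongrightarrow> L) at_top" if "nt_lim_inf f L" for L
  proof -
    have "(f \<longlongrightarrow> L) (at_infinity \<sqinter> principal (nt_cone_inf 1))"
      using that by (simp add: nt_lim_inf_def)
    then show ?thesis by (rule filterlim_compose[OF _ filterlim_vertical_at_infinity])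
  qed
  show "\<not> nt_lim_inf_infty f"
  proof
    assume "nt_lim_inf_infty f"
    then have "filterlim f at_infinity (at_infinity \<sqinter> principal (nt_cone_inf 1))"
      by (simp add: nt_lim_inf_infty_def)
    then have "filterlim (\<lambda>y. f (Complex 0 y)) at_infinity at_top"
      by (rule filterlim_compose[OF _ filterlim_vertical_at_infinity])
    with v[OF lim] show False
      using not_tendsto_and_filterlim_at_infinity[OF trivial_limit_at_top_linorder] by blast
  qed
  show "nt_lim_inf f L' \<Longrightarrow> L' = L"
    using tendsto_unique[OF _ v[of L'] v[OF lim]] by simp
  have sq: "(\<lambda>n. f (zs n)) \<longlonglongrightarrow> L"
    if "c > 0" "\<And>n. zs n \<in> nt_cone_inf c" "filterlim zs at_infinity sequentially" for c zs
  proof -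
    have 1: "(f \<longlongrightarrow> L) (at_infinity \<sqinter> principal (nt_cone_inf c))"
      using lim that by (simp add: nt_lim_inf_def)
    have 2: "filterlim zs (at_infinity \<sqinter> principal (nt_cone_inf c)) sequentially"
      using that by (simp add: filterlim_inf filterlim_principal)
    show ?thesis by (rule filterlim_compose[OF 1 2])
  qed
  have V: "nt_limit_values_inf f \<subseteq> {L}"
    unfolding nt_limit_values_inf_def using sq LIMSEQ_unique by blast
  then have fin: "nt_cluster_fin f \<subseteq> {L}"
    unfolding nt_cluster_fin_def by (rule closure_minimal) simp
  \<comment> \<open>Boundedness excludes infinity as a closure point of the set of limit
    values.\<close>
  have bdd: "bounded (nt_limit_values_inf f)" by (rule bounded_subset[OF _ V]) simp
  have "\<not> nt_cluster_has_infty f"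
  proof
    assume "nt_cluster_has_infty f"
    then obtain c zs where c: "c > 0" "\<And>n. zs n \<in> nt_cone_inf c" "filterlim zs at_infinity sequentially"
      and i: "filterlim (\<lambda>n. f (zs n)) at_infinity sequentially"
      unfolding nt_cluster_has_infty_def using bdd by auto
    show False
      by (rule not_tendsto_and_filterlim_at_infinity[OF sequentially_bot sq[OF c] i])
  qed
  then show "\<not> nt_cluster_more_than_one f"
    unfolding nt_cluster_more_than_one_def using fin by auto
qed

text \<open>By the open mapping theorem a non-constant map into the closed lower half-plane misses
  the real axis; a real constant is its own nontangential limit.\<close>

lemma Im_neg_of_no_real_limit:
  assumes hol: "\<phi> holomorphic_on upper_half" and vals: "\<And>z. Im z > 0 \<Longrightarrow> Im (\<phi> z) \<le> 0"
    and no: "\<And>b s. \<not> nt_lim_at \<phi> b (of_real s)" and z: "Im z > 0"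
  shows "Im (\<phi> z) < 0"
proof (rule ccontr)
  assume "\<not> Im (\<phi> z) < 0"
  then have z0: "Im (\<phi> z) = 0" using vals[OF z] by simp
  show False
  proof (cases "\<phi> constant_on upper_half")
    case True
    then have c: "\<phi> u = \<phi> z" if "Im u > 0" for u
      using that z unfolding constant_on_def by (metis mem_upper_half)
    have "nt_lim_at \<phi> 0 (\<phi> z)"
      unfolding nt_lim_at_def
      by (intro allI impI tendsto_eventually)
         (auto simp: eventually_at_filter nt_cone_def intro!: always_eventually c)
    moreover have "\<phi> z = of_real (Re (\<phi> z))" using z0 by (simp add: complex_eq_iff)
    ultimately show False using no by metis
  next
    case False
    have "open (\<phi> ` upper_half)"
      by (rule open_mapping_thm[OF hol open_upper_half connected_upper_half open_upper_half order_refl False])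
    moreover have "\<phi> z \<in> \<phi> ` upper_half" using z by simp
    ultimately obtain e where e: "e > 0" "ball (\<phi> z) e \<subseteq> \<phi> ` upper_half"
      using open_contains_ball by blast
    have "\<phi> z + \<i> * of_real (e / 2) \<in> ball (\<phi> z) e" using e by (simp add: dist_norm norm_mult)
    then obtain u where "Im u > 0" "\<phi> u = \<phi> z + \<i> * of_real (e / 2)" using e(2) by (metis imageE mem_upper_half subsetD)
    then show False using vals[of u] z0 e by simp
  qed
qed

text \<open>Excludes real accumulation points of the fixed points. Julia's inequality is tested at w
  = a + \<i> y; the possible behaviours of F_\<nu> down this line (escape, interior accumulation,
  real accumulation) are refuted one by one.\<close>

lemma no_boundary_fixed_point:
  assumes \<nu>: "borel_prob \<nu>" and hol: "\<phi> holomorphic_on upper_half"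
    and neg: "\<And>z. Im z > 0 \<Longrightarrow> Im (\<phi> z) < 0"
    and no: "\<And>b s. \<not> nt_lim_at \<phi> b (of_real s)"
    and no_inf: "\<And>s. \<not> nt_lim_inf \<phi> (of_real s)"
  shows "\<exists>w. Im w > 0 \<and> \<not> (cmod (of_real x - \<phi> (F_transform \<nu> w) - of_real a))\<^sup>2 * Im w
      \<le> (cmod (w - of_real a))\<^sup>2 * Im (- \<phi> (F_transform \<nu> w))"
proof (rule ccontr)
  assume "\<not> ?thesis"
  then have julia: "(cmod (of_real x - \<phi> (F_transform \<nu> w) - of_real a))\<^sup>2 * Im w
      \<le> (cmod (w - of_real a))\<^sup>2 * Im (- \<phi> (F_transform \<nu> w))" if "Im w > 0" for w
    using that by blast
  define \<psi> where "\<psi> z = - \<phi> z" for z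
  have \<psi>hol: "\<psi> holomorphic_on upper_half" unfolding \<psi>_def by (intro holomorphic_intros hol)
  have \<psi>pos: "Im (\<psi> z) > 0" if "Im z > 0" for z using neg[OF that] by (simp add: \<psi>_def)
  define y where "y n = 1 / real (Suc n)" for n
  define g where "g n = F_transform \<nu> (Complex a (y n))" for n
  have y: "y n > 0" "y n \<le> 1" for n by (auto simp: y_def)
  have y0: "y \<longlonglongrightarrow> 0" unfolding y_def using LIMSEQ_inverse_real_of_nat by (simp add: inverse_eq_divide)
  have gy: "Im (g n) \<ge> y n" for n
    using Im_F_transform_ge[OF \<nu>, of "Complex a (y n)"] y[of n] by (simp add: g_def)
  then have gpos: "Im (g n) > 0" for n using y(1)[of n] by (meson less_le_trans)
  \<comment> \<open>At a + \<i> y the distance to \<open>a\<close> equals the height y. With d =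
    \<psi>(g) - (a - x) Julia's inequality reads |d|^2 * y \<le> y^2 * Im d \<le> y^2 * |d|, since a
    - x is real.\<close>
  have near: "cmod (\<psi> (g n) - of_real (a - x)) \<le> y n" for n
  proof -
    let ?d = "\<psi> (g n) - of_real (a - x)"
    have "Complex a (y n) - of_real a = \<i> * of_real (y n)" by (simp add: complex_eq_iff)
    then have c: "cmod (Complex a (y n) - of_real a) = y n" using y(1)[of n] by (simp add: norm_mult)
    have "(cmod ?d)\<^sup>2 * y n \<le> (y n)\<^sup>2 * Im (\<psi> (g n))"
      using julia[of "Complex a (y n)"] y(1)[of n] unfolding c g_def[symmetric]
      by (simp add: \<psi>_def algebra_simps)
    also have "\<dots> \<le> (y n)\<^sup>2 * cmod ?d"
      using abs_Im_le_cmod[of ?d] by (intro mult_left_mono) auto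
    finally have "(y n * cmod ?d) * cmod ?d \<le> (y n * cmod ?d) * y n"
      by (simp add: power2_eq_square mult_ac)
    moreover have "cmod ?d > 0" using \<psi>pos[OF gpos[of n]] by (auto simp: complex_eq_iff)
    ultimately show ?thesis using y(1)[of n] by (simp add: mult_le_cancel_left_pos)
  qed
  have Im_le: "Im (\<psi> (g n)) \<le> y n" for n
    using near[of n] abs_Im_le_cmod[of "\<psi> (g n) - of_real (a - x)"] by simp
  have \<psi>lim: "(\<lambda>n. \<psi> (g n)) \<longlonglongrightarrow> of_real (a - x)"
    by (rule Lim_null[THEN iffD2], rule Lim_null_comparison[OF _ y0]) (use near in auto)
  show False
  proof (cases "filterlim g at_infinity sequentially")
    case True
    obtain C where C: "\<And>y. 0 < y \<Longrightarrow> y \<le> 1 \<Longrightarrow>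
        y * (cmod (F_transform \<nu> (Complex a y)))\<^sup>2 \<le> C * Im (F_transform \<nu> (Complex a y))"
      using vertical_F_transform_bound[OF \<nu>, of a] by blast
    have Cle: "Im (\<psi> (g n)) * (cmod (g n))\<^sup>2 \<le> C * Im (g n)" for n
    proof -
      have "Im (\<psi> (g n)) * (cmod (g n))\<^sup>2 \<le> y n * (cmod (g n))\<^sup>2"
        by (intro mult_right_mono Im_le) simp
      also have "\<dots> \<le> C * Im (g n)" unfolding g_def by (intro C y)
      finally show ?thesis .
    qed
    have "nt_lim_inf \<psi> (of_real (a - x))"
      by (rule nt_lim_inf_of_julia[OF \<psi>hol \<psi>pos gpos True \<psi>lim Cle])
    then have "nt_lim_inf \<phi> (- of_real (a - x))"
      unfolding nt_lim_inf_def \<psi>_def by (subst (asm) tendsto_minus_cancel_left[symmetric]) simp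
    then show False using no_inf[of "x - a"] by simp
  next
    case False
    then obtain R where "R > 0" "\<not> (\<forall>\<^sub>F n in sequentially. R \<le> cmod (g n))"
      unfolding filterlim_at_infinity[OF order_refl] by blast
    then have "\<exists>\<^sub>F n in sequentially. cmod (g n) < R" by (simp add: not_eventually not_le)
    then have "infinite {n. cmod (g n) < R}"
      by (simp add: frequently_cofinite flip: cofinite_eq_sequentially)
    then obtain r :: "nat \<Rightarrow> nat" where r: "strict_mono r" "\<And>n. cmod (g (r n)) < R"
      using infinite_enumerate by blast
    then have "bounded (range (g \<circ> r))" unfolding bounded_iff by (auto intro: less_imp_le)
    then obtain l r' where r': "strict_mono r'" "((g \<circ> r) \<circ> r') \<longlonglongrightarrow> l"
      using bounded_imp_convergent_subsequence by blast
    define q where "q = r \<circ> r'"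
    have q: "strict_mono q" unfolding q_def using r r' strict_mono_o by blast
    have gl: "(\<lambda>n. g (q n)) \<longlonglongrightarrow> l" using r' by (simp add: q_def o_def)
    have \<psi>q: "(\<lambda>n. \<psi> (g (q n))) \<longlonglongrightarrow> of_real (a - x)"
      using LIMSEQ_subseq_LIMSEQ[OF \<psi>lim q] by (simp add: o_def)
    have "Im l \<ge> 0"
      using tendsto_Im[OF gl] by (rule LIMSEQ_le_const) (use gpos less_imp_le in blast)
    then consider "Im l > 0" | "Im l = 0" by fastforce
    then show False
    proof cases
      case 1
      have "isCont \<psi> l"
        using \<psi>hol open_upper_half 1
        by (meson continuous_on_eq_continuous_at holomorphic_on_imp_continuous_on mem_upper_half)
      then have "(\<lambda>n. \<psi> (g (q n))) \<longlonglongrightarrow> \<psi> l" by (rule isCont_tendsto_compose[OF _ gl])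
      then have "\<psi> l = of_real (a - x)" using \<psi>q LIMSEQ_unique by blast
      then show False using \<psi>pos[OF 1] by simp
    next
      case 2
      then have l: "l = of_real (Re l)" by (simp add: complex_eq_iff)
      have "nt_lim_at \<psi> (Re l) (of_real (a - x))"
      proof (rule nt_lim_at_of_julia[OF \<psi>hol \<psi>pos gpos _ \<psi>q])
        show "(\<lambda>n. g (q n)) \<longlonglongrightarrow> of_real (Re l)" using gl l by simp
        \<comment> \<open>The value has height at most y and the argument at least y, so the
          boundary quotient is at most 1.\<close>
        show "Im (\<psi> (g (q n))) \<le> Im (g (q n))" for n using Im_le gy order_trans by blast
      qed
      then have "nt_lim_at \<phi> (Re l) (- of_real (a - x))"
        unfolding nt_lim_at_def \<psi>_def by (subst (asm) tendsto_minus_cancel_left[symmetric]) simp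
      then show False using no[of "Re l" "x - a"] by simp
    qed
  qed
qed

section \<open>Voiculescu transforms and subordination\<close>

lemma holomorphic_on_compose_upper:
  assumes "f holomorphic_on S" "g holomorphic_on upper_half" "\<And>z. z \<in> S \<Longrightarrow> Im (f z) > 0"
  shows "(\<lambda>z. g (f z)) holomorphic_on S"
proof -
  have "f ` S \<subseteq> upper_half" using assms(3) by auto
  from holomorphic_on_compose_gen[OF assms(1,2) this] show ?thesis by (simp add: o_def)
qed

lemma trunc_cone_mono:
  assumes "\<alpha> \<le> \<beta>" "M \<le> R"
  shows "trunc_cone \<beta> R \<subseteq> trunc_cone \<alpha> M"
proof
  fix z assume z: "z \<in> trunc_cone \<beta> R"
  have "\<alpha> * \<bar>Re z\<bar> \<le> \<beta> * \<bar>Re z\<bar>" using assms by (intro mult_right_mono) auto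
  then show "z \<in> trunc_cone \<alpha> M" using z assms by (auto simp: trunc_cone_def)
qed

lemma open_trunc_cone: "open (trunc_cone \<alpha> M)"
  unfolding trunc_cone_def
  by (intro open_Collect_conj open_Collect_less continuous_intros)

lemma imaginary_in_trunc_cone: "Y > 0 \<Longrightarrow> Y > M \<Longrightarrow> \<i> * of_real Y \<in> trunc_cone \<alpha> M"
  by (simp add: trunc_cone_def norm_mult)

text \<open>The closed cone meets the real axis at 0 alone, and \<open>M > 0\<close> removes 0, so
  the bounded part lies in a compact subset of the half-plane. Used to force large values of F to
  come from large points.\<close>

lemma F_transform_bounded_on_cone:
  assumes \<mu>: "borel_prob \<mu>" and \<alpha>: "\<alpha> > 0" and M: "M > 0"
  obtains B where "\<And>\<zeta>. \<zeta> \<in> trunc_cone \<alpha> M \<Longrightarrow> cmod \<zeta> \<le> R \<Longrightarrow> cmod (F_transform \<mu> \<zeta>) \<le> B"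
proof -
  define K where "K = cball 0 R \<inter> ({z. M \<le> cmod z} \<inter> {z. \<alpha> * \<bar>Re z\<bar> \<le> Im z})"
  have "closed ({z. M \<le> cmod z} \<inter> {z. \<alpha> * \<bar>Re z\<bar> \<le> Im z})"
    by (intro closed_Int closed_Collect_le continuous_intros)
  then have "compact K" unfolding K_def by (intro compact_Int_closed compact_cball)
  moreover have "K \<subseteq> upper_half"
  proof
    fix z assume "z \<in> K"
    then have z: "M \<le> cmod z" "\<alpha> * \<bar>Re z\<bar> \<le> Im z" by (auto simp: K_def)
    have "\<alpha> * \<bar>Re z\<bar> \<ge> 0" using \<alpha> by simp
    moreover have "Im z \<noteq> 0"
    proof
      assume "Im z = 0"
      then have "Re z = 0" using z(2) \<alpha> by (simp add: mult_le_0_iff)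
      then have "z = 0" using \<open>Im z = 0\<close> by (simp add: complex_eq_iff)
      then show False using z(1) M by simp
    qed
    ultimately show "z \<in> upper_half" using z(2) by simp
  qed
  then have "continuous_on K (F_transform \<mu>)"
    using F_transform_holomorphic[OF \<mu>] continuous_on_subset holomorphic_on_imp_continuous_on by blast
  ultimately have "bounded (F_transform \<mu> ` K)"
    by (intro compact_imp_bounded compact_continuous_image)
  then obtain B where "\<And>z. z \<in> K \<Longrightarrow> cmod (F_transform \<mu> z) \<le> B" unfolding bounded_iff by auto
  then show ?thesis using that[of B] by (auto simp: K_def trunc_cone_def)
qed

text \<open>With \<zeta> = z + \<phi> z the inverse relation gives \<phi> z = \<zeta> - F(\<zeta>),
  small relative to \<zeta>. Since |\<zeta>| \<le> |z| + |\<phi> z| and the factor is at most 1/2,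
  the term |\<phi> z| can be absorbed on the left.\<close>

lemma voiculescu_asymp:
  assumes \<mu>: "borel_prob \<mu>" and v: "voiculescu_on \<mu> \<phi> \<alpha> M" and e: "\<epsilon> > 0"
  obtains R where "R \<ge> M" "\<And>z. z \<in> trunc_cone \<alpha> R \<Longrightarrow> cmod (\<phi> z) \<le> \<epsilon> * cmod z"
proof -
  obtain \<alpha>0 M0 where 0: "\<alpha>0 > 0" "M0 > 0"
    and inv: "\<And>z. z \<in> trunc_cone \<alpha> M \<Longrightarrow> z + \<phi> z \<in> trunc_cone \<alpha>0 M0 \<and> F_transform \<mu> (z + \<phi> z) = z"
    using v unfolding voiculescu_on_def by blast
  define \<delta> where "\<delta> = min (1 / 2) (\<epsilon> / 2)"
  have d: "\<delta> > 0" "\<delta> \<le> 1 / 2" "2 * \<delta> \<le> \<epsilon>" using e by (auto simp: \<delta>_def)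
  obtain R1 where R1: "R1 > 0" "\<And>\<zeta>. \<zeta> \<in> trunc_cone \<alpha>0 R1 \<Longrightarrow> cmod (F_transform \<mu> \<zeta> - \<zeta>) \<le> \<delta> * cmod \<zeta>"
    using F_transform_asymp[OF \<mu> 0(1) d(1)] by blast
  obtain B where B: "\<And>\<zeta>. \<zeta> \<in> trunc_cone \<alpha>0 M0 \<Longrightarrow> cmod \<zeta> \<le> R1 \<Longrightarrow> cmod (F_transform \<mu> \<zeta>) \<le> B"
    using F_transform_bounded_on_cone[OF \<mu> 0] by blast
  show ?thesis
  proof (rule that[of "max M B"])
    fix z assume z: "z \<in> trunc_cone \<alpha> (max M B)"
    define \<zeta> where "\<zeta> = z + \<phi> z"
    have zM: "z \<in> trunc_cone \<alpha> M" and zB: "cmod z > B" using z by (auto simp: trunc_cone_def)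
    have \<zeta>: "\<zeta> \<in> trunc_cone \<alpha>0 M0" "F_transform \<mu> \<zeta> = z" using inv[OF zM] by (auto simp: \<zeta>_def)
    \<comment> \<open>Points beyond \<open>B\<close> are not values of F on the part of the cone
      within radius \<open>R1\<close>, so the asymptotics of F apply at
      \<open>\<zeta>\<close>.\<close>
    have "cmod \<zeta> > R1" using B[OF \<zeta>(1)] \<zeta>(2) zB by force
    then have "\<zeta> \<in> trunc_cone \<alpha>0 R1" using \<zeta>(1) by (simp add: trunc_cone_def)
    from R1(2)[OF this] have "cmod (\<phi> z) \<le> \<delta> * cmod \<zeta>"
      unfolding \<zeta>(2) by (simp add: \<zeta>_def norm_minus_commute)
    also have "\<dots> \<le> \<delta> * (cmod z + cmod (\<phi> z))"
      unfolding \<zeta>_def using d by (intro mult_left_mono norm_triangle_ineq) auto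
    also have "\<dots> \<le> \<delta> * cmod z + 1 / 2 * cmod (\<phi> z)"
      using mult_right_mono[OF d(2), of "cmod (\<phi> z)"] by (simp add: distrib_left)
    finally have "cmod (\<phi> z) \<le> (2 * \<delta>) * cmod z" by simp
    also have "\<dots> \<le> \<epsilon> * cmod z" by (intro mult_right_mono d) auto
    finally show "cmod (\<phi> z) \<le> \<epsilon> * cmod z" .
  qed simp
qed

text \<open>The aperture 1 + 4 \<alpha> gives \<alpha> |Re z| < Im z / 4 and |z| \<le> 2 Im z; the
  latter turns the bound on \<open>d\<close> into (1 + \<alpha>) |d| \<le> Im z / 2, so the two
  losses stay below Im z.\<close>

lemma trunc_cone_perturb:
  assumes \<alpha>: "\<alpha> > 0" and \<beta>: "\<beta> \<ge> 1 + 4 * \<alpha>" and M: "M > 0"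
    and z: "z \<in> trunc_cone \<beta> (2 * M)" and d: "cmod d \<le> 1 / (4 * (1 + \<alpha>)) * cmod z"
  shows "z + d \<in> trunc_cone \<alpha> M"
proof -
  have \<beta>0: "\<beta> > 0" using \<alpha> \<beta> by simp
  have z1: "cmod z > 2 * M" "Im z > \<beta> * \<bar>Re z\<bar>" using z by (auto simp: trunc_cone_def)
  have Imz: "Im z > 0" using trunc_cone_Im_pos[OF z \<beta>0] .
  have "(1 + 4 * \<alpha>) * \<bar>Re z\<bar> \<le> \<beta> * \<bar>Re z\<bar>" using \<beta> by (intro mult_right_mono) auto
  then have re: "\<bar>Re z\<bar> + 4 * (\<alpha> * \<bar>Re z\<bar>) < Im z" using z1 by (simp add: algebra_simps)
  have are: "\<alpha> * \<bar>Re z\<bar> \<ge> 0" using \<alpha> by simp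
  have zz: "cmod z \<le> 2 * Im z" using cmod_le[of z] re are Imz by linarith
  have "4 * ((1 + \<alpha>) * cmod d) \<le> cmod z"
    using d \<alpha> by (simp add: field_simps)
  then have dd: "cmod d + \<alpha> * cmod d \<le> Im z / 2" using zz by (simp add: algebra_simps)
  have ad: "\<alpha> * cmod d \<ge> 0" using \<alpha> by simp
  have "\<bar>Re (z + d)\<bar> \<le> \<bar>Re z\<bar> + cmod d" using abs_Re_le_cmod[of d] by simp
  then have "\<alpha> * \<bar>Re (z + d)\<bar> \<le> \<alpha> * (\<bar>Re z\<bar> + cmod d)" using \<alpha> by (intro mult_left_mono) auto
  also have "\<dots> = \<alpha> * \<bar>Re z\<bar> + \<alpha> * cmod d" by (simp add: algebra_simps)
  also have "\<dots> < Im z - cmod d" using re are dd Imz by linarith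
  also have "\<dots> \<le> Im (z + d)" using abs_Im_le_cmod[of d] by simp
  finally have 1: "\<alpha> * \<bar>Re (z + d)\<bar> < Im (z + d)" .
  have "cmod d \<le> cmod z / 2" using dd ad zz abs_Im_le_cmod[of z] by linarith
  moreover have "cmod z - cmod d \<le> cmod (z + d)" using norm_diff_ineq by blast
  ultimately have "cmod (z + d) > M" using z1 by linarith
  with 1 show ?thesis by (simp add: trunc_cone_def)
qed

text \<open>\<open>voiculescu_on\<close> lets each transform choose its own cone of injectivity.
  Since \<open>\<phi>1 z\<close> is o(|z|), the point \<open>z + \<phi>1 z\<close> enters the cone
  belonging to \<open>\<phi>2\<close>, where injectivity of F identifies the two inverses.\<close>

lemma voiculescu_unique:
  assumes \<mu>: "borel_prob \<mu>" and v1: "voiculescu_on \<mu> \<phi>1 \<alpha>1 M1" and v2: "voiculescu_on \<mu> \<phi>2 \<alpha>2 M2"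
  obtains \<beta> R where "\<beta> > 0" "trunc_cone \<beta> R \<subseteq> trunc_cone \<alpha>1 M1"
    "\<And>z. z \<in> trunc_cone \<beta> R \<Longrightarrow> \<phi>1 z = \<phi>2 z"
proof -
  have pos: "\<alpha>1 > 0" "M1 > 0" "\<alpha>2 > 0" "M2 > 0" using v1 v2 by (auto simp: voiculescu_on_def)
  have inv1: "\<And>z. z \<in> trunc_cone \<alpha>1 M1 \<Longrightarrow> F_transform \<mu> (z + \<phi>1 z) = z"
    using v1 unfolding voiculescu_on_def by blast
  obtain \<alpha>0 M0 where 0: "\<alpha>0 > 0" "M0 > 0" and inj: "inj_on (F_transform \<mu>) (trunc_cone \<alpha>0 M0)"
    and inv2: "\<And>z. z \<in> trunc_cone \<alpha>2 M2 \<Longrightarrow> z + \<phi>2 z \<in> trunc_cone \<alpha>0 M0 \<and> F_transform \<mu> (z + \<phi>2 z) = z"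
    using v2 unfolding voiculescu_on_def by blast
  have "1 / (4 * (1 + \<alpha>0)) > 0" using 0 by simp
  then obtain R1 where R1: "R1 \<ge> M1"
    "\<And>z. z \<in> trunc_cone \<alpha>1 R1 \<Longrightarrow> cmod (\<phi>1 z) \<le> 1 / (4 * (1 + \<alpha>0)) * cmod z"
    using voiculescu_asymp[OF \<mu> v1] by blast
  \<comment> \<open>Adding all apertures makes \<open>\<beta>\<close> dominate each of them.\<close>
  define \<beta> where "\<beta> = 1 + 4 * \<alpha>0 + \<alpha>1 + \<alpha>2"
  define R where "R = max (2 * M0) (max R1 M2)"
  have sub: "trunc_cone \<beta> R \<subseteq> trunc_cone \<alpha>1 R1" "trunc_cone \<beta> R \<subseteq> trunc_cone \<alpha>1 M1"
    "trunc_cone \<beta> R \<subseteq> trunc_cone \<alpha>2 M2" "trunc_cone \<beta> R \<subseteq> trunc_cone \<beta> (2 * M0)"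
    by (rule trunc_cone_mono; use 0 pos R1(1) in \<open>simp add: \<beta>_def R_def\<close>)+
  show ?thesis
  proof (rule that[of \<beta> R])
    fix z assume z: "z \<in> trunc_cone \<beta> R"
    have "z + \<phi>1 z \<in> trunc_cone \<alpha>0 M0"
      by (rule trunc_cone_perturb[OF 0(1) _ 0(2), of \<beta>])
         (use z sub R1(2) pos in \<open>auto simp: \<beta>_def\<close>)
    moreover have "F_transform \<mu> (z + \<phi>1 z) = F_transform \<mu> (z + \<phi>2 z)"
      using inv1 inv2 z sub by (metis subsetD)
    ultimately have "z + \<phi>1 z = z + \<phi>2 z" using inj inv2 z sub(3) by (meson inj_onD subsetD)
    then show "\<phi>1 z = \<phi>2 z" by simp
  qed (use sub 0 pos in \<open>auto simp: \<beta>_def\<close>)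
qed

text \<open>Provides \<open>growth\<close> of \<open>pick_shift\<close>: F_\<nu>(\<i> Y) = \<i> Y +
  o(Y) remains in a cone where \<phi> is small relative to its argument.\<close>

lemma voiculescu_compose_growth:
  assumes \<mu>: "borel_prob \<mu>" and v: "voiculescu_on \<mu> \<phi> \<alpha> M" and \<nu>: "borel_prob \<nu>"
  shows "((\<lambda>Y::real. \<phi> (F_transform \<nu> (\<i> * of_real Y)) / of_real Y) \<longlongrightarrow> 0) at_top"
proof (rule tendstoI)
  fix e :: real assume e: "e > 0"
  have \<alpha>: "\<alpha> > 0" and M: "M > 0" using v by (auto simp: voiculescu_on_def)
  \<comment> \<open>Since |F_\<nu>(\<i> Y)| \<le> 2 Y, the final bound is e * Y / 2, strictly below
    e * Y.\<close>
  have "e / 4 > 0" using e by simp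
  then obtain R where R: "R \<ge> M" "\<And>z. z \<in> trunc_cone \<alpha> R \<Longrightarrow> cmod (\<phi> z) \<le> e / 4 * cmod z"
    using voiculescu_asymp[OF \<mu> v] by blast
  have "1 / (4 * (1 + \<alpha>)) > 0" using \<alpha> by simp
  then obtain R1 where R1: "R1 > 0"
    "\<And>z. z \<in> trunc_cone 1 R1 \<Longrightarrow> cmod (F_transform \<nu> z - z) \<le> 1 / (4 * (1 + \<alpha>)) * cmod z"
    using F_transform_asymp[OF \<nu> zero_less_one] by blast
  have "\<forall>\<^sub>F Y in at_top. Y > max R1 (2 * R)" by (rule eventually_gt_at_top)
  then show "\<forall>\<^sub>F Y in at_top. dist (\<phi> (F_transform \<nu> (\<i> * of_real Y)) / of_real Y) 0 < e"
  proof eventually_elim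
    case (elim Y)
    define z where "z = \<i> * of_real Y"
    have Y: "Y > 0" "Y > R1" "Y > 2 * R" using elim R1(1) by auto
    have cz: "cmod z = Y" using Y by (simp add: z_def norm_mult)
    have "z \<in> trunc_cone 1 R1" unfolding z_def by (rule imaginary_in_trunc_cone) (use Y in auto)
    from R1(2)[OF this] have d: "cmod (F_transform \<nu> z - z) \<le> 1 / (4 * (1 + \<alpha>)) * cmod z" .
    have "z + (F_transform \<nu> z - z) \<in> trunc_cone \<alpha> R"
    proof (rule trunc_cone_perturb[OF \<alpha> order_refl _ _ d])
      show "z \<in> trunc_cone (1 + 4 * \<alpha>) (2 * R)"
        unfolding z_def by (rule imaginary_in_trunc_cone) (use Y in auto)
    qed (use R M in simp)
    then have "cmod (\<phi> (F_transform \<nu> z)) \<le> e / 4 * cmod (F_transform \<nu> z)" using R(2) by simp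
    also have "\<dots> \<le> e / 4 * (2 * Y)"
    proof (rule mult_left_mono)
      have "1 / (4 * (1 + \<alpha>)) * cmod z \<le> 1 * cmod z"
        using \<alpha> by (intro mult_right_mono) (auto simp: field_simps)
      then show "cmod (F_transform \<nu> z) \<le> 2 * Y"
        using d norm_triangle_sub[of "F_transform \<nu> z" z] cz by simp
    qed (use e in simp)
    also have "\<dots> < e * Y" using mult_pos_pos[OF e Y(1)] by (simp add: mult.commute)
    finally have "cmod (\<phi> (F_transform \<nu> z)) < e * Y" .
    then show ?case using Y by (simp add: z_def norm_divide field_simps)
  qed
qed

text \<open>Near infinity let w = F_\<rho>(u) and v = w + \<phi>2 w. Then F_\<nu>(v) = w and v +
  \<phi>(F_\<nu>(v)) = u, so \<omega>(u) = v and F_\<rho>(u) = F_\<nu>(\<omega>(u)). Analytic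
  continuation spreads this over the half-plane.\<close>

lemma subordination:
  assumes \<mu>: "borel_prob \<mu>" and \<nu>: "borel_prob \<nu>" and conv: "free_conv \<mu> \<nu> \<rho>"
    and v: "voiculescu_on \<mu> \<phi> \<alpha>' M'"
    and \<omega>hol: "\<omega> holomorphic_on upper_half" and \<omega>pos: "\<And>z. Im z > 0 \<Longrightarrow> Im (\<omega> z) > 0"
    and \<omega>inv: "\<And>w. Im w > 0 \<Longrightarrow> Im (w + \<phi> (F_transform \<nu> w)) > 0 \<Longrightarrow> \<omega> (w + \<phi> (F_transform \<nu> w)) = w"
    and z: "Im z > 0"
  shows "cauchy_transform \<rho> z = cauchy_transform \<nu> (\<omega> z)"
proof -
  have \<rho>: "borel_prob \<rho>" using conv by (simp add: free_conv_def)
  obtain \<alpha> M \<phi>1 \<phi>2 where v1: "voiculescu_on \<mu> \<phi>1 \<alpha> M" and v2: "voiculescu_on \<nu> \<phi>2 \<alpha> M"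
    and v3: "voiculescu_on \<rho> (\<lambda>z. \<phi>1 z + \<phi>2 z) \<alpha> M"
    using conv unfolding free_conv_def by blast
  obtain \<beta> R where \<beta>: "\<beta> > 0" and sub: "trunc_cone \<beta> R \<subseteq> trunc_cone \<alpha> M"
    and eq: "\<And>z. z \<in> trunc_cone \<beta> R \<Longrightarrow> \<phi>1 z = \<phi> z"
    using voiculescu_unique[OF \<mu> v1 v] by blast
  obtain \<alpha>0 M0 where 0: "\<alpha>0 > 0" "M0 > 0" and inj: "inj_on (F_transform \<rho>) (trunc_cone \<alpha>0 M0)"
    and inv3: "\<And>z. z \<in> trunc_cone \<alpha> M \<Longrightarrow> z + (\<phi>1 z + \<phi>2 z) \<in> trunc_cone \<alpha>0 M0 \<and>
      F_transform \<rho> (z + (\<phi>1 z + \<phi>2 z)) = z"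
    using v3 unfolding voiculescu_on_def by blast
  obtain \<alpha>2 M2 where 2: "\<alpha>2 > 0"
    and inv2: "\<And>z. z \<in> trunc_cone \<alpha> M \<Longrightarrow> z + \<phi>2 z \<in> trunc_cone \<alpha>2 M2 \<and> F_transform \<nu> (z + \<phi>2 z) = z"
    using v2 unfolding voiculescu_on_def by blast
  \<comment> \<open>A preimage rather than an image, so that openness follows from continuity of
    F_\<rho>.\<close>
  define U where "U = trunc_cone \<alpha>0 M0 \<inter> F_transform \<rho> -` trunc_cone \<beta> R"
  have TCu: "trunc_cone \<alpha>0 M0 \<subseteq> upper_half" using trunc_cone_Im_pos[OF _ 0(1)] by auto
  have "continuous_on (trunc_cone \<alpha>0 M0) (F_transform \<rho>)"
    using F_transform_holomorphic[OF \<rho>] TCu continuous_on_subset holomorphic_on_imp_continuous_on by blast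
  then have oU: "open U" unfolding U_def by (intro continuous_open_preimage open_trunc_cone)
  have "\<i> * of_real (\<bar>R\<bar> + 1) \<in> trunc_cone \<beta> R" by (rule imaginary_in_trunc_cone) auto
  then have "U \<noteq> {}" using inv3 sub unfolding U_def by fastforce
  have UG: "cauchy_transform \<rho> u = cauchy_transform \<nu> (\<omega> u)" if u: "u \<in> U" for u
  proof -
    define w where "w = F_transform \<rho> u"
    have u0: "u \<in> trunc_cone \<alpha>0 M0" and w: "w \<in> trunc_cone \<beta> R" using u by (auto simp: U_def w_def)
    have wM: "w \<in> trunc_cone \<alpha> M" using w sub by blast
    have "w + (\<phi>1 w + \<phi>2 w) = u"
      using inj_onD[OF inj _ _ u0] inv3[OF wM] by (auto simp: w_def)
    moreover define v where "v = w + \<phi>2 w"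
    ultimately have vu: "v + \<phi> (F_transform \<nu> v) = u"
      using inv2[OF wM] eq[OF w] by (simp add: algebra_simps)
    have "Im v > 0" unfolding v_def using inv2[OF wM] trunc_cone_Im_pos[OF _ 2] by blast
    moreover have "Im u > 0" using u0 TCu by auto
    ultimately have "\<omega> u = v" using \<omega>inv[of v] vu by simp
    then have "F_transform \<nu> (\<omega> u) = F_transform \<rho> u" using inv2[OF wM] by (simp add: v_def w_def)
    then show ?thesis by (simp add: F_transform_def)
  qed
  have "(\<lambda>z. cauchy_transform \<nu> (\<omega> z)) holomorphic_on upper_half"
    by (rule holomorphic_on_compose_upper[OF \<omega>hol cauchy_transform_holomorphic[OF \<nu>]]) (simp add: \<omega>pos)
  moreover have "U \<subseteq> upper_half" using TCu by (auto simp: U_def)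
  moreover have "z \<in> upper_half" using z by simp
  ultimately show ?thesis
    using analytic_continuation_open[OF oU open_upper_half \<open>U \<noteq> {}\<close> connected_upper_half _
        cauchy_transform_holomorphic[OF \<rho>] _ UG] by metis
qed

text \<open>Near a solution of \<Phi>(w) = x the local inverse \<open>h\<close> of \<Phi> extends
  \<open>\<omega>\<close> across \<open>x\<close> with values in the half-plane, so G_\<nu> o h is
  the required continuation.\<close>

lemma free_conv_extends_at:
  assumes \<mu>: "borel_prob \<mu>" and \<nu>: "borel_prob \<nu>" and conv: "free_conv \<mu> \<nu> \<rho>"
    and v: "voiculescu_on \<mu> \<phi> \<alpha> M" and hol: "\<phi> holomorphic_on upper_half"
    and neg: "\<And>z. Im z > 0 \<Longrightarrow> Im (\<phi> z) < 0"
    and no: "\<And>b s. \<not> nt_lim_at \<phi> b (of_real s)"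
    and no_inf: "\<And>s. \<not> nt_lim_inf \<phi> (of_real s)"
  shows "cauchy_extends_at \<rho> x"
proof -
  define k where "k w = \<phi> (F_transform \<nu> w)" for w
  have Fpos: "Im (F_transform \<nu> w) > 0" if "Im w > 0" for w
    using Im_F_transform_ge[OF \<nu> that] that by simp
  interpret pick_shift k
  proof
    show "k holomorphic_on upper_half"
      unfolding k_def
      by (rule holomorphic_on_compose_upper[OF F_transform_holomorphic[OF \<nu>] hol]) (simp add: Fpos)
    show "((\<lambda>Y. k (\<i> * of_real Y) / of_real Y) \<longlongrightarrow> 0) at_top"
      unfolding k_def by (rule voiculescu_compose_growth[OF \<mu> v \<nu>])
  qed (use neg Fpos in \<open>auto simp: k_def\<close>)
  obtain \<omega> where \<omega>: "\<omega> holomorphic_on upper_half" "\<And>z. Im z > 0 \<Longrightarrow> Im (\<omega> z) > 0"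
    "\<And>w. Im w > 0 \<Longrightarrow> Im (w + k w) > 0 \<Longrightarrow> \<omega> (w + k w) = w"
    using holomorphic_solution by blast
  have sub: "cauchy_transform \<rho> z = cauchy_transform \<nu> (\<omega> z)" if "Im z > 0" for z
    by (rule subordination[OF \<mu> \<nu> conv v \<omega>[unfolded k_def] that])
  obtain w where w: "Im w > 0" "w + k w = of_real x"
  proof (rule real_solution_or_julia[of x])
    fix a :: real
    assume "\<And>w. Im w > 0 \<Longrightarrow> (cmod (of_real x - k w - of_real a))\<^sup>2 * Im w \<le> (cmod (w - of_real a))\<^sup>2 * Im (- k w)"
    then show thesis
      using no_boundary_fixed_point[OF \<nu> hol neg no no_inf, of x a] unfolding k_def by blast
  qed (rule that)
  let ?\<Phi> = "\<lambda>w. w + k w"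
  have \<Phi>hol: "?\<Phi> holomorphic_on upper_half" by (intro holomorphic_intros hol_k)
  obtain d where d: "d > 0" "ball w d \<subseteq> upper_half" "open (?\<Phi> ` ball w d)" "inj_on ?\<Phi> (ball w d)"
    using has_complex_derivative_locally_invertible[OF \<Phi>hol _ open_upper_half deriv_nonzero_at_real_solution[OF w]] w
    by auto
  obtain h where h: "h holomorphic_on ?\<Phi> ` ball w d" "\<And>u. u \<in> ball w d \<Longrightarrow> h (u + k u) = u"
    by (rule holomorphic_has_inverse[OF holomorphic_on_subset[OF \<Phi>hol d(2)] open_ball d(4)]) (rule that)
  have "of_real x \<in> ?\<Phi> ` ball w d" using w(2) d(1) by (metis centre_in_ball image_eqI)
  then obtain r where r: "r > 0" "ball (of_real x) r \<subseteq> ?\<Phi> ` ball w d"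
    using d(3) open_contains_ball by blast
  have hb: "h z \<in> ball w d" "h z + k (h z) = z" if z: "z \<in> ball (of_real x) r" for z
    using r(2) z h(2) by (auto simp: subset_iff)
  have hpos: "Im (h z) > 0" if z: "z \<in> ball (of_real x) r" for z
    using hb(1)[OF z] d(2) by auto
  show ?thesis
    unfolding cauchy_extends_at_def
  proof (intro exI[of _ r] conjI r(1) exI[of _ "\<lambda>z. cauchy_transform \<nu> (h z)"] ballI impI)
    show "(\<lambda>z. cauchy_transform \<nu> (h z)) holomorphic_on ball (of_real x) r"
      by (rule holomorphic_on_compose_upper[OF holomorphic_on_subset[OF h(1) r(2)] cauchy_transform_holomorphic[OF \<nu>] hpos])
    fix z assume z: "z \<in> ball (complex_of_real x) r"
    show "Im (cauchy_transform \<nu> (h z)) < 0" by (rule Im_cauchy_transform_neg[OF \<nu> hpos[OF z]])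
    assume "Im z > 0"
    \<comment> \<open>Above the axis \<Phi>(h z) = z, so the left-inverse property gives
      \<open>\<omega> z = h z\<close>.\<close>
    then show "cauchy_transform \<nu> (h z) = cauchy_transform \<rho> z"
      using sub[of z] \<omega>(3)[OF hpos[OF z]] hb(2)[OF z] by simp
  qed
qed

theorem mainTheorem1:
  fixes \<mu> :: "real measure" and \<phi> :: "complex \<Rightarrow> complex"
  assumes ID: "free_inf_div \<mu>"
    and hol: "\<phi> holomorphic_on upper_half"
    and vals: "\<forall>z\<in>upper_half. Im (\<phi> z) \<le> 0"
    and ext: "\<exists>\<alpha> M. voiculescu_on \<mu> \<phi> \<alpha> M"
    and H1: "\<forall>x::real. (\<exists>L. nt_lim_at \<phi> x L \<and> Im L < 0)
               \<or> ((\<nexists>L. nt_lim_at \<phi> x L) \<and> \<not> nt_lim_at_infty_value \<phi> x)"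
    and H2: "nt_lim_inf_infty \<phi> \<or> (\<exists>L. nt_lim_inf \<phi> L \<and> Im L < 0)
               \<or> nt_cluster_more_than_one \<phi>"
  shows "\<forall>\<nu> \<rho>. borel_prob \<nu> \<longrightarrow> free_conv \<mu> \<nu> \<rho> \<longrightarrow>
           (\<exists>f::real \<Rightarrow> real. (\<forall>x. f x > 0) \<and> real_analytic_on f UNIV \<and>
              \<rho> = density lborel (\<lambda>x. ennreal (f x)))"
proof (intro allI impI)
  fix \<nu> \<rho> assume \<nu>: "borel_prob \<nu>" and conv: "free_conv \<mu> \<nu> \<rho>"
  have \<mu>: "borel_prob \<mu>" using ID by (simp add: free_inf_div_def)
  have \<rho>: "borel_prob \<rho>" using conv by (simp add: free_conv_def)
  obtain \<alpha> M where v: "voiculescu_on \<mu> \<phi> \<alpha> M" using ext by blast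
  \<comment> \<open>By uniqueness a real limit would coincide with the limit in the lower half-plane
    granted by \<open>H1\<close>; the other alternative of \<open>H1\<close> excludes any finite
    limit.\<close>
  have no: "\<not> nt_lim_at \<phi> b (of_real s)" for b s
  proof
    assume l: "nt_lim_at \<phi> b (of_real s)"
    then obtain L where "nt_lim_at \<phi> b L" "Im L < 0" using H1 by blast
    then show False using nt_lim_at_unique[OF l] by force
  qed
  \<comment> \<open>A finite limit rules out the alternatives of an infinite limit and of a larger
    cluster set; uniqueness rules out a limit in the lower half-plane.\<close>
  have no_inf: "\<not> nt_lim_inf \<phi> (of_real s)" for s
  proof
    assume l: "nt_lim_inf \<phi> (of_real s)"
    then obtain L where "nt_lim_inf \<phi> L" "Im L < 0"
      using H2 nt_lim_inf_excludes(1,3)[OF l] by blast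
    then show False using nt_lim_inf_excludes(2)[OF l] by force
  qed
  have neg: "Im (\<phi> z) < 0" if "Im z > 0" for z
    by (rule Im_neg_of_no_real_limit[OF hol _ no that]) (use vals in auto)
  have "cauchy_extends_at \<rho> x" for x
    by (rule free_conv_extends_at[OF \<mu> \<nu> conv v hol neg no no_inf])
  then obtain f where "\<And>x. f x > 0" "real_analytic_on f UNIV" "\<rho> = density lborel (\<lambda>x. ennreal (f x))"
    using stieltjes_inversion[OF \<rho>] by blast
  then show "\<exists>f::real \<Rightarrow> real. (\<forall>x. f x > 0) \<and> real_analytic_on f UNIV \<and> \<rho> = density lborel (\<lambda>x. ennreal (f x))"
    by blast
qed

end
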